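(* Let $n\ge1$ be an integer, and suppose that either (upper case) $p>-1$ and $\zeta=j_{p+1,n}^2$, or (lower case) $p>0$ and $\zeta=j_{p-1,n}^2$. For $k\ge0$ let $\beta_k=D_p^{(k)}(\zeta)/k!$ be the Taylor coefficients of $D_p$ at $\zeta$. Then: (i) for every integer $r\ge1$, $\displaystyle\sum_{m\ge1}\frac{1}{\left(j_{p,m}^{2}-\zeta\right)^r}=\beta_{r-1}$; (ii) $\beta_0=0$ in the upper case and $\beta_0=p/\zeta$ in the lower case; (iii) $\zeta\beta_1-\zeta\beta_0^2+(p+1)\beta_0-\frac14=0$, and for every integer $k\ge1$ $$\beta_{k+1}=\frac{1}{\zeta(k+1)}\left[\zeta\sum_{j=0}^{k}\beta_j\beta_{k-j}+\sum_{j=0}^{k-1}\beta_j\beta_{k-1-j}-(k+p+1)\beta_k\right].$$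
   Context: For real $\nu>-1$, $J_\nu$ is the Bessel function of the first kind of order $\nu$ and $j_{\nu,m}$ denotes its $m$th positive zero ($m\ge1$). The function $D_p$ is $$D_p(x)=\frac{J_{p+1}(\sqrt{x})}{2\sqrt{x}\,J_p(\sqrt{x})},$$ defined for $x>0$ with $J_p(\sqrt x)\ne0$; since Bessel functions of adjacent orders have no common positive zeros, $D_p$ is analytic in a neighbourhood of $\zeta$ in each of the two cases. *)

theory Defs
  imports "HOL-Analysis.Analysis"
begin

text \<open>
  Real-valued Bessel function of the first kind, by its power series. Only positive arguments
  are meaningful, since \<^term>\<open>(powr)\<close> is a genuine real power only for a positive base.
\<close>

definition bessel_J :: "real \<Rightarrow> real \<Rightarrow> real" where
  "bessel_J \<nu> x =
     (\<Sum>m. (- 1) ^ m / (fact m * Gamma (real m + \<nu> + 1)) * (x / 2) powr (2 * real m + \<nu>))"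

text \<open>
  The zeros are numbered from \<open>m = 1\<close>. The cardinality of an infinite set is \<open>0\<close>, so for
  \<open>m \<ge> 1\<close> the condition also says that there are only finitely many zeros up to \<open>x\<close>.
\<close>

definition bessel_zero :: "real \<Rightarrow> nat \<Rightarrow> real" where
  "bessel_zero \<nu> m =
     (THE x. x > 0 \<and> bessel_J \<nu> x = 0 \<and> card {y. 0 < y \<and> y \<le> x \<and> bessel_J \<nu> y = 0} = m)"

definition bessel_D :: "real \<Rightarrow> real \<Rightarrow> real" where
  "bessel_D p x = bessel_J (p + 1) (sqrt x) / (2 * sqrt x * bessel_J p (sqrt x))"

end

theory Submission
  imports Defs "HOL-Real_Asymp.Real_Asymp" "HOL-Complex_Analysis.Great_Picard"
begin

text \<open>
  Write \<open>J\<^sub>\<nu>(x) = (x/2)\<^sup>\<nu> F\<^sub>\<nu>(x\<^sup>2/4)\<close> with \<open>F\<^sub>\<nu>\<close> entire. Then \<open>F\<^sub>\<nu>' = - F\<^sub>\<nu>\<^sub>+\<^sub>1\<close>, so that \<open>D\<^sub>p\<close> is minus the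
  logarithmic derivative of \<open>x \<mapsto> F\<^sub>p(x/4)\<close>, and the three-term recurrence turns into a Riccati equation
  for \<open>D\<^sub>p\<close>, whose successive derivatives give the recurrence for the Taylor coefficients.

  What remains is the expansion of \<open>D\<^sub>p\<close> in the partial fractions \<open>1 / (j\<^sup>2 - x)\<close>. By Rolle's theorem the
  Laguerre polynomials have only simple positive roots, and rescaled they converge to \<open>F\<^sub>\<nu>\<close>. Their
  logarithmic derivatives, whose reciprocal roots have a fixed sum, converge along a subsequence to
  a constant \<open>c \<ge> 0\<close> plus the partial fractions of the limiting roots. Since \<open>F\<^sub>\<nu>\<^sub>+\<^sub>1(-s) / F\<^sub>\<nu>(-s)\<close>
  tends to \<open>0\<close> as \<open>s\<close> grows, \<open>c = 0\<close>; the same decay, for the next order, forces infinitely many roots.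
\<close>

text \<open>Domination is demanded only eventually in \<open>n\<close>: in the application the
  denominators \<open>1 - t * y n k\<close> may vanish for the first few \<open>n\<close>.\<close>

lemma tannery_sequence:
  fixes a :: "nat \<Rightarrow> nat \<Rightarrow> real"
  assumes "\<And>k. (\<lambda>n. a n k) \<longlonglongrightarrow> b k"
    and "\<forall>\<^sub>F n in sequentially. \<forall>k. \<bar>a n k\<bar> \<le> M k"
    and "summable M"
  shows "(\<lambda>n. \<Sum>k. a n k) \<longlonglongrightarrow> (\<Sum>k. b k)" and "summable b"
proof -
  have "eventually (\<lambda>(k, n). norm (a n k) \<le> M k) (at_top \<times>\<^sub>F sequentially)"
    unfolding eventually_prod_filter
    by (rule exI[of _ "\<lambda>_. True"], rule exI[of _ "\<lambda>n. \<forall>k. \<bar>a n k\<bar> \<le> M k"])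
      (use assms(2) in auto)
  from tannerys_theorem[of "\<lambda>k n. a n k" b sequentially M, OF assms(1) this assms(3)]
  show "(\<lambda>n. \<Sum>k. a n k) \<longlonglongrightarrow> (\<Sum>k. b k)" "summable b"
    using summable_norm_cancel[of b] by auto
qed

subsection \<open>The entire function behind the Bessel function\<close>

text \<open>The alternating sign is left to the argument, so that the weights are positive for
  \<open>\<nu> > -1\<close> and serve as their own majorants.\<close>

definition bessel_weight :: "real \<Rightarrow> nat \<Rightarrow> real" where
  "bessel_weight \<nu> m = 1 / (fact m * Gamma (real m + \<nu> + 1))"

text \<open>This is the Bessel-Clifford function of order \<nu> at \<open>- t\<close>.\<close>

definition bessel_F :: "real \<Rightarrow> real \<Rightarrow> real" where
  "bessel_F \<nu> t = (\<Sum>m. bessel_weight \<nu> m * (- t) ^ m)"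

lemma Gamma_shift:
  assumes "\<nu> > -1"
  shows "Gamma (real m + \<nu> + 2) = (real m + \<nu> + 1) * Gamma (real m + \<nu> + 1)"
  using Gamma_plus1[of "real m + \<nu> + 1"] assms nonpos_Ints_nonpos[of "real m + \<nu> + 1"]
  by (fastforce simp: add_ac)

lemma bessel_weight_pos: "\<nu> > -1 \<Longrightarrow> bessel_weight \<nu> m > 0"
  by (auto simp: bessel_weight_def intro!: divide_pos_pos mult_pos_pos Gamma_real_pos)

lemma bessel_weight_order_Suc:
  assumes "\<nu> > -1"
  shows "bessel_weight \<nu> m = (real m + \<nu> + 1) * bessel_weight (\<nu> + 1) m"
proof -
  have "Gamma (real m + (\<nu> + 1) + 1) = (real m + \<nu> + 1) * Gamma (real m + \<nu> + 1)"
    using Gamma_shift[OF assms, of m] by (simp add: add_ac)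
  moreover have "real m + \<nu> + 1 > 0"
    using assms by simp
  ultimately show ?thesis
    by (simp add: bessel_weight_def)
qed

text \<open>Raising the index and raising the order give the same Gamma argument. This is why
  termwise differentiation raises the order.\<close>

lemma bessel_weight_Suc: "real (Suc m) * bessel_weight \<nu> (Suc m) = bessel_weight (\<nu> + 1) m"
  by (simp add: bessel_weight_def add_ac del: of_nat_Suc) (simp add: add_ac)

text \<open>The two shift identities give
  \<open>(m + 1) * (\<nu> + 1) * w (m + 1) \<le> w m\<close>; iterating produces an exponential
  majorant, whose rate \<open>1 / (\<nu> + 1)\<close> becomes small for large order.\<close>

lemma bessel_weight_le:
  assumes "\<nu> > -1"
  shows "bessel_weight \<nu> m \<le> bessel_weight \<nu> 0 * (inverse (fact m) * (1 / (\<nu> + 1)) ^ m)"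
proof (induction m)
  case (Suc m)
  have "real (Suc m) * bessel_weight \<nu> (Suc m) * (\<nu> + 1)
      \<le> bessel_weight (\<nu> + 1) m * (real m + \<nu> + 1)"
    unfolding bessel_weight_Suc using bessel_weight_pos[of "\<nu> + 1" m] assms
    by (intro mult_left_mono) auto
  also have "\<dots> = bessel_weight \<nu> m"
    using bessel_weight_order_Suc[OF assms] by simp
  finally have "bessel_weight \<nu> (Suc m) \<le> bessel_weight \<nu> m / (real (Suc m) * (\<nu> + 1))"
    using assms by (simp add: pos_le_divide_eq mult_ac del: of_nat_Suc)
  also have "\<dots> \<le> bessel_weight \<nu> 0 * (inverse (fact m) * (1 / (\<nu> + 1)) ^ m)
      / (real (Suc m) * (\<nu> + 1))"
    using assms Suc by (intro divide_right_mono) auto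
  finally show ?case
    using assms by (simp add: field_simps)
qed simp

lemma bessel_weight_summable:
  assumes "\<nu> > -1"
  shows "summable (\<lambda>m. bessel_weight \<nu> m * t ^ m)"
proof (rule summable_comparison_test')
  show "summable (\<lambda>m. bessel_weight \<nu> 0 * (inverse (fact m) * (\<bar>t\<bar> / (\<nu> + 1)) ^ m))"
    by (intro summable_mult summable_exp)
  fix m
  have "bessel_weight \<nu> m * \<bar>t\<bar> ^ m
      \<le> bessel_weight \<nu> 0 * (inverse (fact m) * (1 / (\<nu> + 1)) ^ m) * \<bar>t\<bar> ^ m"
    by (intro mult_right_mono bessel_weight_le assms) auto
  then show "norm (bessel_weight \<nu> m * t ^ m)
      \<le> bessel_weight \<nu> 0 * (inverse (fact m) * (\<bar>t\<bar> / (\<nu> + 1)) ^ m)"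
    using bessel_weight_pos[OF assms, of m]
    by (simp add: abs_mult power_abs power_divide mult_ac)
qed

lemma bessel_F_deriv:
  assumes "\<nu> > -1"
  shows "(bessel_F \<nu> has_real_derivative - bessel_F (\<nu> + 1) t) (at t)"
proof -
  have F: "bessel_F \<nu> = (\<lambda>t. \<Sum>m. ((-1) ^ m * bessel_weight \<nu> m) * t ^ m)" for \<nu>
    unfolding bessel_F_def by (subst power_minus) (simp add: mult_ac)
  have s: "summable (\<lambda>m. ((-1) ^ m * bessel_weight \<nu> m) * y ^ m)" if "\<nu> > -1" for y \<nu>
    using bessel_weight_summable[OF that, of "- y"]
    by (simp add: power_minus[of y] mult_ac)
  have d: "diffs (\<lambda>m. (-1) ^ m * bessel_weight \<nu> m)
      = (\<lambda>m. - ((-1) ^ m * bessel_weight (\<nu> + 1) m))"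
    by (rule ext) (simp add: diffs_def flip: bessel_weight_Suc)
  have "(bessel_F \<nu> has_real_derivative
      (\<Sum>m. diffs (\<lambda>m. (-1) ^ m * bessel_weight \<nu> m) m * t ^ m)) (at t)"
    unfolding F by (rule termdiffs_strong_converges_everywhere) (rule s[OF assms])
  also have "(\<Sum>m. diffs (\<lambda>m. (-1) ^ m * bessel_weight \<nu> m) m * t ^ m) = - bessel_F (\<nu> + 1) t"
    unfolding d F using s[of "\<nu> + 1" t] assms by (simp add: suminf_minus)
  finally show ?thesis .
qed

text \<open>In \<open>w m = (m + \<nu> + 1) * w' m\<close>, with \<open>w'\<close> of the next
  order, the part \<open>\<nu> + 1\<close> gives the first term. The part \<open>m\<close> vanishes
  at \<open>m = 0\<close> and becomes the second term after an index shift.\<close>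

lemma bessel_F_recurrence:
  assumes "\<nu> > -1"
  shows "bessel_F \<nu> t = (\<nu> + 1) * bessel_F (\<nu> + 1) t - t * bessel_F (\<nu> + 2) t"
proof -
  let ?b = "bessel_weight (\<nu> + 1)"
  have b: "bessel_weight (\<nu> + 2) m = real (Suc m) * ?b (Suc m)" for m
    using bessel_weight_Suc[of m "\<nu> + 1"] by (simp add: add_ac)
  have s1: "summable (\<lambda>m. ?b m * (- t) ^ m)"
    using assms by (intro bessel_weight_summable) simp
  have s2: "summable (\<lambda>m. bessel_weight (\<nu> + 2) m * (- t) ^ m)"
    using assms by (intro bessel_weight_summable) simp
  let ?g = "\<lambda>m. real m * ?b m * (- t) ^ m"
  have g: "(\<lambda>m. ?g (Suc m)) = (\<lambda>m. - t * (bessel_weight (\<nu> + 2) m * (- t) ^ m))"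
    unfolding b by (auto simp: mult_ac)
  have "summable (\<lambda>m. ?g (Suc m))"
    unfolding g by (intro summable_mult s2)
  then have s3: "summable ?g"
    by (subst (asm) summable_Suc_iff)
  have "suminf ?g = (\<Sum>m. ?g (Suc m))"
    using suminf_split_head[OF s3] by simp
  also have "\<dots> = - t * bessel_F (\<nu> + 2) t"
    unfolding g bessel_F_def by (intro suminf_mult s2)
  finally have e: "suminf ?g = - t * bessel_F (\<nu> + 2) t" .
  have "bessel_F \<nu> t = (\<Sum>m. (\<nu> + 1) * (?b m * (- t) ^ m) + ?g m)"
    unfolding bessel_F_def bessel_weight_order_Suc[OF assms]
    by (intro suminf_cong) (simp add: algebra_simps)
  also have "\<dots> = (\<nu> + 1) * bessel_F (\<nu> + 1) t + suminf ?g"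
    unfolding bessel_F_def
    by (subst suminf_add[symmetric]) (use s1 s3 in \<open>auto intro: summable_mult simp: suminf_mult\<close>)
  finally show ?thesis
    using e by simp
qed

lemma bessel_F_nonpos_pos:
  assumes "\<nu> > -1" "t \<le> 0"
  shows "bessel_F \<nu> t > 0"
proof -
  have "0 < bessel_weight \<nu> 0"
    by (rule bessel_weight_pos[OF assms(1)])
  also have "\<dots> = (\<Sum>m<1. bessel_weight \<nu> m * (- t) ^ m)"
    by simp
  also have "\<dots> \<le> bessel_F \<nu> t"
    unfolding bessel_F_def using assms bessel_weight_pos[OF assms(1)]
    by (intro sum_le_suminf bessel_weight_summable) (auto simp: less_imp_le)
  finally show ?thesis .
qed

text \<open>A common zero of two consecutive orders would propagate to all higher orders, whereas
  for large order the constant term of the series dominates.\<close>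

lemma bessel_F_no_common_zero:
  assumes "\<nu> > -1" "bessel_F \<nu> t = 0"
  shows "bessel_F (\<nu> + 1) t \<noteq> 0"
proof
  assume "bessel_F (\<nu> + 1) t = 0"
  have t: "t > 0"
    using bessel_F_nonpos_pos[OF assms(1)] assms(2) by (metis less_irrefl not_le)
  have z: "bessel_F (\<nu> + real k) t = 0 \<and> bessel_F (\<nu> + real k + 1) t = 0" for k
  proof (induction k)
    case 0
    then show ?case
      using assms \<open>bessel_F (\<nu> + 1) t = 0\<close> by simp
  next
    case (Suc k)
    have "- 1 < \<nu> + real k"
      using assms by (simp add: add_strict_increasing)
    from bessel_F_recurrence[OF this, of t] Suc t
    show ?case by (simp add: add_ac)
  qed
  \<comment> \<open>This makes the majorant's rate satisfy
    \<open>t / (\<mu> + 1) \<le> 1 / 2\<close>, whence its exponential stays below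
    \<open>2\<close>.\<close>
  obtain k :: nat where k: "real k > 2 * t + 1"
    using reals_Archimedean2 by blast
  define \<mu> where "\<mu> = \<nu> + real k"
  have \<mu>: "\<mu> > -1" "\<mu> + 1 > 2 * t" "\<mu> + 1 > 0"
    using k t assms by (auto simp: \<mu>_def)
  have s: "summable (\<lambda>m. bessel_weight \<mu> m * (- t) ^ m)"
    by (rule bessel_weight_summable[OF \<mu>(1)])
  let ?c = "\<lambda>m. bessel_weight \<mu> 0 * (inverse (fact m) * (t / (\<mu> + 1)) ^ m)"
  have sc: "summable ?c"
    by (intro summable_mult summable_exp)
  have c: "suminf ?c = bessel_weight \<mu> 0 * exp (t / (\<mu> + 1))"
    by (subst suminf_mult) (auto intro: summable_exp simp: exp_def divide_inverse scaleR_conv_of_real)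
  have "0 = bessel_F \<mu> t"
    using z[of k] by (simp add: \<mu>_def)
  have le: "\<bar>bessel_weight \<mu> m * (- t) ^ m\<bar> \<le> ?c m" for m
    using mult_right_mono[OF bessel_weight_le[OF \<mu>(1), of m], of "t ^ m"] t
      bessel_weight_pos[OF \<mu>(1), of m]
    by (simp add: abs_mult power_abs power_divide mult_ac)
  define x where "x = t / (\<mu> + 1)"
  have x: "0 \<le> x" "x \<le> 1 / 2"
    using \<mu> t by (auto simp: x_def field_simps)
  have "exp x \<le> 1 + x + x\<^sup>2"
    using x by (intro exp_bound) auto
  moreover have "x\<^sup>2 \<le> (1 / 2)\<^sup>2"
    using x by (intro power_mono)
  ultimately have e: "exp x < 2"
    using x by (simp add: power2_eq_square)
  \<comment> \<open>Each series term plus its majorant is nonnegative, and for \<open>m = 0\<close>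
    they add up to twice the constant term. As the series itself sums to \<open>0\<close>, the
    majorant alone would have to reach that value.\<close>
  have "2 * bessel_weight \<mu> 0 = (\<Sum>m<1. bessel_weight \<mu> m * (- t) ^ m + ?c m)"
    by simp
  also have "\<dots> \<le> (\<Sum>m. bessel_weight \<mu> m * (- t) ^ m + ?c m)"
    using le by (intro sum_le_suminf summable_add s sc) (simp add: abs_le_iff, smt (verit))
  also have "\<dots> = bessel_F \<mu> t + bessel_weight \<mu> 0 * exp x"
    using suminf_add[OF s sc] c by (simp add: bessel_F_def x_def)
  finally show False
    using e z[of k] bessel_weight_pos[OF \<mu>(1), of 0] by (simp add: \<mu>_def)
qed

subsection \<open>Real-rootedness of the Laguerre polynomials\<close>

text \<open>In the usual normalisation this is \<open>n! / \<Gamma>(n + \<nu> + 1) * L\<^sub>n\<^sup>(\<^sup>\<nu>\<^sup>)(s)\<close>.\<close>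

definition laguerre :: "nat \<Rightarrow> real \<Rightarrow> real poly" where
  "laguerre n \<nu> = (\<Sum>m\<le>n. monom ((-1) ^ m * real (n choose m) / Gamma (real m + \<nu> + 1)) m)"

lemma coeff_laguerre:
  "coeff (laguerre n \<nu>) m = (-1) ^ m * real (n choose m) / Gamma (real m + \<nu> + 1)"
proof -
  have "coeff (laguerre n \<nu>) m
      = (\<Sum>i\<le>n. if i = m then (-1) ^ m * real (n choose m) / Gamma (real m + \<nu> + 1) else 0)"
    unfolding laguerre_def coeff_sum by (intro sum.cong) auto
  then show ?thesis
    by (auto simp: binomial_eq_0)
qed

lemma degree_laguerre: "degree (laguerre n \<nu>) \<le> n"
  by (intro degree_le) (auto simp: coeff_laguerre binomial_eq_0)

lemma laguerre_at_0:
  "poly (laguerre n \<nu>) 0 = 1 / Gamma (\<nu> + 1)"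
  by (simp add: poly_0_coeff_0 coeff_laguerre)

text \<open>On coefficients this is Pascal's rule. The right side is what remains of the derivative
  of \<open>exp (- s) * s powr (\<nu> + 1) * laguerre n (\<nu> + 1)\<close> after dividing by
  \<open>exp (- s) * s powr \<nu>\<close>.\<close>

lemma laguerre_Suc:
  assumes "\<nu> > -1"
  shows "laguerre (Suc n) \<nu>
    = [:\<nu> + 1, -1:] * laguerre n (\<nu> + 1) + [:0, 1:] * pderiv (laguerre n (\<nu> + 1))"
proof (rule poly_eqI)
  fix m
  have G: "Gamma (real m + \<nu> + 1) > 0" for m
    using assms by (intro Gamma_real_pos) (simp add: add_strict_increasing)
  have r: "real m + \<nu> + 1 > 0" for m
    using assms by (simp add: add_strict_increasing)
  show "coeff (laguerre (Suc n) \<nu>) m = coeff ([:\<nu> + 1, -1:] * laguerre n (\<nu> + 1)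
      + [:0, 1:] * pderiv (laguerre n (\<nu> + 1))) m"
  proof (cases m)
    case 0
    then show ?thesis
      using Gamma_shift[OF assms, of 0] G[of 0] r[of 0]
      by (simp add: coeff_laguerre add_ac)
  next
    case (Suc k)
    define G r where "G = Gamma (real k + \<nu> + 2)" and "r = real k + \<nu> + 2"
    have pos: "G > 0" "r > 0"
      using G[of "Suc k"] r[of "Suc k"] by (simp_all add: G_def r_def add_ac)
    have "Gamma (real (Suc k) + (\<nu> + 1) + 1) = r * G"
      using Gamma_shift[OF assms, of "Suc k"] by (simp add: G_def r_def add_ac)
    then have A: "coeff (laguerre n (\<nu> + 1)) (Suc k) = (-1) ^ Suc k * real (n choose Suc k) / (r * G)"
      unfolding coeff_laguerre by simp
    have B: "coeff (laguerre n (\<nu> + 1)) k = (-1) ^ k * real (n choose k) / G"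
      and C: "coeff (laguerre (Suc n) \<nu>) (Suc k) = (-1) ^ Suc k * real (Suc n choose Suc k) / G"
      unfolding coeff_laguerre G_def by (simp_all add: add_ac)
    have D: "coeff ([:\<nu> + 1, -1:] * laguerre n (\<nu> + 1)
          + [:0, 1:] * pderiv (laguerre n (\<nu> + 1))) (Suc k)
        = r * coeff (laguerre n (\<nu> + 1)) (Suc k) - coeff (laguerre n (\<nu> + 1)) k"
      by (simp add: coeff_pderiv r_def algebra_simps)
    show ?thesis
      unfolding Suc D A B C using pos by (simp add: field_simps)
  qed
qed

section \<open>Positive simple roots by Rolle's theorem\<close>

lemma exp_powr_tendsto_0: "((\<lambda>s::real. exp (- s) * s powr a) \<longlongrightarrow> 0) at_top"
  by real_asymp

lemma exp_powr_poly_tendsto_0: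
  "((\<lambda>s::real. exp (- s) * s powr a * poly p s) \<longlongrightarrow> 0) at_top"
proof -
  have "((\<lambda>s. \<Sum>i\<le>degree p. coeff p i * (exp (- s) * s powr (a + real i))) \<longlongrightarrow> 0) at_top"
    by (intro tendsto_null_sum tendsto_mult_right_zero exp_powr_tendsto_0)
  moreover have "\<forall>\<^sub>F s in at_top. (\<Sum>i\<le>degree p. coeff p i * (exp (- s) * s powr (a + real i)))
      = exp (- s) * s powr a * poly p s"
    using eventually_gt_at_top[of 0]
    by eventually_elim
      (simp add: poly_altdef sum_distrib_left powr_add powr_realpow mult_ac)
  ultimately show ?thesis
    by (rule Lim_transform_eventually)
qed

text \<open>If \<open>g b\<close> is nonzero, half of this value is attained both before and after
  \<open>b\<close> by the intermediate value theorem, which reduces the claim to Rolle's theorem on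
  a compact interval.\<close>

lemma Rolle_half_line:
  fixes g g' :: "real \<Rightarrow> real"
  assumes "g a = 0" "(g \<longlongrightarrow> 0) at_top" "continuous_on {a..} g"
    and d: "\<And>x. x > a \<Longrightarrow> (g has_real_derivative g' x) (at x)"
  shows "\<exists>w>a. g' w = 0"
proof (cases "\<forall>x>a. g x = 0")
  case True
  then have "g' (a + 1) = 0"
    using DERIV_local_const[OF d[of "a + 1"], of 1] by (auto simp: abs_real_def)
  then show ?thesis
    by (intro exI[of _ "a + 1"]) auto
next
  case False
  then obtain b where b: "b > a" "g b \<noteq> 0"
    by auto
  define v where "v = g b / 2"
  have "\<forall>\<^sub>F x in at_top. \<bar>g x\<bar> < \<bar>v\<bar>"
    using tendstoD[OF assms(2), of "\<bar>v\<bar>"] b by (simp add: v_def dist_real_def)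
  then obtain c where c: "c > b" "\<bar>g c\<bar> < \<bar>v\<bar>"
    using eventually_happens[OF eventually_conj[OF _ eventually_gt_at_top[of b]]] by fastforce
  have cont: "continuous_on {l..u} g" if "a \<le> l" for l u
    using that by (intro continuous_on_subset[OF assms(3)]) auto
  have "connected (g ` {a..b})" "connected (g ` {b..c})"
    using cont b by (auto intro!: connected_continuous_image)
  then have "v \<in> g ` {a..b}" "v \<in> g ` {b..c}"
    unfolding connected_iff_interval using b c assms(1)
    unfolding v_def by (smt (verit, ccfv_SIG) atLeastAtMost_iff imageI field_sum_of_halves)+
  then obtain l u where lu: "a \<le> l" "l \<le> b" "g l = v" "b \<le> u" "g u = v"
    by auto
  have "l \<noteq> b" "u \<noteq> b"
    using lu b by (auto simp: v_def)
  with lu have "l < u"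
    by auto
  \<comment> \<open>\<open>Rolle_deriv\<close> treats the derivative as a linear map; evaluating
    that map at \<open>1\<close> recovers the number \<open>g' w\<close>.\<close>
  from Rolle_deriv[OF this _ cont, of "\<lambda>x. (*) (g' x)"] lu d
  obtain w where "l < w" "(*) (g' w) = (\<lambda>v. 0)"
    by (auto simp: has_field_derivative_def)
  then show ?thesis
    using lu by (intro exI[of _ w]) (auto dest: fun_cong[of _ _ 1])
qed

text \<open>Rolle's theorem applies because \<open>exp (- s) * s powr \<nu> * laguerre (n + 1) \<nu>\<close> is the derivative of
  \<open>exp (- s) * s powr (\<nu> + 1) * laguerre n (\<nu> + 1)\<close>, which vanishes at \<open>0\<close>, at the \<open>n\<close> roots of
  \<open>laguerre n (\<nu> + 1)\<close>, and at infinity.\<close>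

lemma laguerre_roots:
  assumes "\<nu> > -1"
  shows "\<exists>z. z 0 = 0 \<and> (\<forall>k<n. z k < z (Suc k)) \<and> (\<forall>k<n. poly (laguerre n \<nu>) (z (Suc k)) = 0)"
  using assms
proof (induction n arbitrary: \<nu>)
  case 0
  show ?case by auto
next
  case (Suc n)
  let ?L = "laguerre n (\<nu> + 1)"
  define g where "g = (\<lambda>s. exp (- s) * s powr (\<nu> + 1) * poly ?L s)"
  define g' where "g' = (\<lambda>s. exp (- s) * s powr \<nu> * poly (laguerre (Suc n) \<nu>) s)"
  obtain z :: "nat \<Rightarrow> real" where z: "z 0 = 0" "\<And>k. k < n \<Longrightarrow> z k < z (Suc k)"
    "\<And>k. k < n \<Longrightarrow> poly ?L (z (Suc k)) = 0"
    using Suc.IH[of "\<nu> + 1"] Suc.prems by auto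
  have z0: "z k \<ge> 0" if "k \<le> n" for k
    using that
  proof (induction k)
    case (Suc k)
    then show ?case
      using z(2)[of k] by simp
  qed (simp add: z)
  have gz: "g (z k) = 0" if "k \<le> n" for k
    using that z(1) z(3)[of "k - 1"] by (cases k) (auto simp: g_def)
  have dg: "(g has_real_derivative g' s) (at s)" if "s > 0" for s
  proof -
    have "(g has_real_derivative exp (- s) * s powr (\<nu> + 1) * poly (pderiv ?L) s
        + (exp (- s) * ((\<nu> + 1) * s powr \<nu>) + - exp (- s) * s powr (\<nu> + 1)) * poly ?L s) (at s)"
      unfolding g_def using that
      by (auto intro!: derivative_eq_intros simp: algebra_simps)
    also have "s powr (\<nu> + 1) = s * s powr \<nu>"
      using that by (simp add: powr_add)
    finally show ?thesis
      using that by (simp add: g'_def laguerre_Suc[OF Suc.prems] algebra_simps)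
  qed
  have cg: "continuous_on {l..} g" if "l \<ge> 0" for l
    unfolding g_def using that Suc.prems
    by (intro continuous_intros continuous_on_powr') auto
  \<comment> \<open>The gaps between consecutive points supply \<open>n\<close> critical points, and
    the half-line beyond \<open>z n\<close> supplies one more.\<close>
  have "\<exists>w. z k < w \<and> (k < n \<longrightarrow> w < z (Suc k)) \<and> g' w = 0" if "k \<le> n" for k
  proof (cases "k < n")
    case True
    have "continuous_on {z k..z (Suc k)} g"
      by (rule continuous_on_subset[OF cg[OF z0[OF that]]]) auto
    from Rolle_deriv[OF z(2)[OF True] _ this, of "\<lambda>x. (*) (g' x)"]
      gz[of k] gz[of "Suc k"] True dg z0[OF that]
    obtain w where "z k < w" "w < z (Suc k)" "(*) (g' w) = (\<lambda>v. 0)"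
      by (auto simp: has_field_derivative_def)
    then show ?thesis
      by (intro exI[of _ w]) (auto dest: fun_cong[of _ _ 1])
  next
    case False
    have "(g \<longlongrightarrow> 0) at_top"
      unfolding g_def by (rule exp_powr_poly_tendsto_0)
    with Rolle_half_line[of g "z k" g'] gz[OF that] cg dg z0[OF that] False
    show ?thesis by auto
  qed
  then obtain w where w: "\<And>k. k \<le> n \<Longrightarrow> z k < w k"
    "\<And>k. k < n \<Longrightarrow> w k < z (Suc k)" "\<And>k. k \<le> n \<Longrightarrow> g' (w k) = 0"
    by (metis less_imp_le_nat)
  have "w k < w (Suc k)" if "k < n" for k
    using w(2)[OF that] w(1)[of "Suc k"] that by simp
  moreover have "poly (laguerre (Suc n) \<nu>) (w k) = 0" if "k \<le> n" for k
    using w(3)[OF that] w(1)[OF that] z0[OF that] by (simp add: g'_def)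
  moreover have "w 0 > 0"
    using w(1)[of 0] z by simp
  \<comment> \<open>Index \<open>0\<close> is a sentinel for the left endpoint \<open>0\<close>, not
    a root, so the new roots move up by one index.\<close>
  ultimately show ?case
    by (intro exI[of _ "\<lambda>k. case k of 0 \<Rightarrow> 0 | Suc j \<Rightarrow> w j"]) (auto split: nat.split)
qed

text \<open>The \<open>y k\<close> are the reciprocal roots. Both sides of the product formula have
  degree at most \<open>n\<close> and agree at the \<open>n\<close> roots and at \<open>0\<close>.
  Differentiating at \<open>0\<close>, where every factor is \<open>1\<close>, gives the sum of the
  \<open>y k\<close>.\<close>

lemma laguerre_factorization:
  assumes "\<nu> > -1"
  obtains y where "\<And>k. k < n \<Longrightarrow> y k > 0" "\<And>k. Suc k < n \<Longrightarrow> y (Suc k) < y k"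
    "\<And>s. poly (laguerre n \<nu>) s = (\<Prod>k<n. 1 - s * y k) / Gamma (\<nu> + 1)"
    "(\<Sum>k<n. y k) = real n / (\<nu> + 1)"
proof -
  obtain z :: "nat \<Rightarrow> real" where z: "z 0 = 0" "\<And>k. k < n \<Longrightarrow> z k < z (Suc k)"
    "\<And>k. k < n \<Longrightarrow> poly (laguerre n \<nu>) (z (Suc k)) = 0"
    using laguerre_roots[OF assms, of n] by blast
  have mono: "z i < z j" if "i < j" "j \<le> n" for i j
    using that
  proof (induction j)
    case (Suc j)
    then show ?case
      using z(2)[of j] by (cases "i = j") auto
  qed simp
  have pos: "z (Suc k) > 0" if "k < n" for k
    using mono[of 0 "Suc k"] that z(1) by simp
  define y where "y = (\<lambda>k. 1 / z (Suc k))"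
  define q where "q = smult (1 / Gamma (\<nu> + 1)) (\<Prod>k<n. [:1, - y k:])"
  have q: "poly q s = (\<Prod>k<n. 1 - s * y k) / Gamma (\<nu> + 1)" for s
    by (simp add: q_def poly_prod)
  have "degree q \<le> degree (\<Prod>k<n. [:1, - y k:])"
    unfolding q_def by (rule degree_smult_le)
  also have "\<dots> \<le> sum (degree \<circ> (\<lambda>k. [:1, - y k:])) {..<n}"
    by (rule degree_prod_sum_le) simp
  also have "\<dots> \<le> (\<Sum>k<n. 1)"
    by (intro sum_mono) (auto intro: order_trans[OF degree_pCons_le])
  finally have dq: "degree q \<le> n"
    by simp
  have "inj_on z {..n}"
    by (intro linorder_inj_onI) (use mono in force)+
  then have card: "card (z ` {..n}) = Suc n"
    by (simp add: card_image)
  have "laguerre n \<nu> = q"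
  proof (rule poly_eqI_degree[of "z ` {..n}"])
    fix x assume "x \<in> z ` {..n}"
    then obtain j where j: "j \<le> n" "x = z j" by auto
    show "poly (laguerre n \<nu>) x = poly q x"
    proof (cases j)
      case 0
      then show ?thesis
        using j z(1) by (simp add: q laguerre_at_0)
    next
      case (Suc k)
      then have "k < n" using j by simp
      then have "(\<Prod>i<n. 1 - z (Suc k) * y i) = 0"
        using pos[of k] by (intro prod_zero) (auto simp: y_def intro!: bexI[of _ k])
      then show ?thesis
        using z(3)[OF \<open>k < n\<close>] j Suc by (simp add: q)
    qed
  qed (use card dq degree_laguerre[of n \<nu>] in auto)
  then have eq: "poly (laguerre n \<nu>) s = (\<Prod>k<n. 1 - s * y k) / Gamma (\<nu> + 1)" for s
    by (simp add: q)
  have G: "Gamma (\<nu> + 1) > 0"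
    using assms by (intro Gamma_real_pos) simp
  have "((\<lambda>s. \<Prod>k<n. 1 - s * y k) has_real_derivative (\<Sum>k<n. - y k)) (at 0)"
  proof -
    have "((\<lambda>s. \<Prod>k<n. 1 - s * y k) has_real_derivative
        (\<Prod>k<n. 1 - 0 * y k) * (\<Sum>k<n. - y k / (1 - 0 * y k))) (at 0)"
      by (rule has_field_derivative_prod') (auto intro!: derivative_eq_intros)
    then show ?thesis by simp
  qed
  then have "(poly (laguerre n \<nu>) has_real_derivative (\<Sum>k<n. - y k) / Gamma (\<nu> + 1)) (at 0)"
    unfolding eq[abs_def] by (rule DERIV_cdivide)
  moreover have "(poly (laguerre n \<nu>) has_real_derivative poly (pderiv (laguerre n \<nu>)) 0) (at 0)"
    by (rule poly_DERIV)
  ultimately have "(\<Sum>k<n. - y k) / Gamma (\<nu> + 1) = poly (pderiv (laguerre n \<nu>)) 0"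
    by (rule DERIV_unique)
  also have "\<dots> = - real n / ((\<nu> + 1) * Gamma (\<nu> + 1))"
    using Gamma_shift[OF assms, of 0]
    by (simp add: poly_0_coeff_0 coeff_pderiv coeff_laguerre add_ac)
  finally have "(\<Sum>k<n. y k) = real n / (\<nu> + 1)"
    using G assms by (simp add: sum_negf divide_simps mult_ac del: distrib_left_numeral)
  moreover have "y (Suc k) < y k" if "Suc k < n" for k
    using mono[of "Suc k" "Suc (Suc k)"] that pos[of k] pos[of "Suc k"]
    by (simp add: y_def field_simps)
  ultimately show ?thesis
    using pos eq by (intro that[of y]) (auto simp: y_def)
qed

section \<open>Convergence of the rescaled Laguerre polynomials\<close>

lemma choose_ratio_le_1: "real (n choose m) * fact m / real n ^ m \<le> 1"
proof (cases "n = 0 \<and> m > 0")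
  case False
  have "real ((n choose m) * fact m) \<le> real (n ^ m)"
    by (rule of_nat_mono[OF binomial_fact_pow])
  moreover have "real n ^ m > 0"
    using False by auto
  ultimately show ?thesis
    by (simp add: field_simps)
qed (auto simp: zero_power)

text \<open>The ratio is the product of \<open>(n - i) / n\<close> over \<open>i < m\<close>, a
  fixed number of factors tending to \<open>1\<close>.\<close>

lemma choose_ratio_tendsto_1: "(\<lambda>n. real (n choose m) * fact m / real n ^ m) \<longlonglongrightarrow> 1"
proof (induction m)
  case (Suc m)
  have "real (n choose Suc m) * fact (Suc m) / real n ^ Suc m
      = real (n choose m) * fact m / real n ^ m * ((real n - real m) / real n)" for n
  proof -
    have "real (Suc m * (n choose Suc m)) = (real n - real m) * real (n choose m)"
    proof (cases "m \<le> n")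
      case True
      then show ?thesis
        using binomial_absorb_comp[of n m] binomial_absorption[of m "n"]
        by (metis binomial_absorption of_nat_diff of_nat_mult)
    qed (simp add: binomial_eq_0)
    then have "real (n choose Suc m) * fact (Suc m)
        = real (n choose m) * fact m * (real n - real m)"
      by (simp add: mult_ac distrib_right)
    then show ?thesis
      by (simp del: fact_Suc)
  qed
  moreover have "(\<lambda>n. (real n - real m) / real n) \<longlonglongrightarrow> 1"
    by real_asymp
  ultimately show ?case
    using tendsto_mult[OF Suc] by fastforce
qed simp

lemma poly_eq_suminf: "poly p (x :: real) = (\<Sum>m. coeff p m * x ^ m)"
  by (subst suminf_finite[of "{..degree p}"]) (auto simp: poly_altdef coeff_eq_0)

text \<open>The series at a bound \<open>T\<close> of the sequence \<open>t\<close> dominates. The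
  argument may move with \<open>n\<close> because the result is applied along roots and critical
  points.\<close>

lemma bessel_F_tannery:
  assumes "\<nu> > -1" "t \<longlonglongrightarrow> l" "\<And>m. (\<lambda>n. a n m) \<longlonglongrightarrow> 1" "\<And>n m. \<bar>a n m\<bar> \<le> 1"
  shows "(\<lambda>n. \<Sum>m. a n m * (bessel_weight \<nu> m * (- t n) ^ m)) \<longlonglongrightarrow> bessel_F \<nu> l"
proof -
  obtain T where T: "\<And>n. \<bar>t n\<bar> \<le> T"
    using convergent_imp_Bseq[OF convergentI[OF assms(2)]] by (auto simp: Bseq_def)
  have "T \<ge> 0"
    using T[of 0] by linarith
  show ?thesis
    unfolding bessel_F_def
  proof (rule tannery_sequence)
    show "(\<lambda>n. a n m * (bessel_weight \<nu> m * (- t n) ^ m)) \<longlonglongrightarrow> bessel_weight \<nu> m * (- l) ^ m" for m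
      using tendsto_mult[OF assms(3)[of m] tendsto_mult[OF tendsto_const
        tendsto_power[OF tendsto_minus[OF assms(2)], of m], of "bessel_weight \<nu> m"]] by simp
    show "\<forall>\<^sub>F n in sequentially. \<forall>m. \<bar>a n m * (bessel_weight \<nu> m * (- t n) ^ m)\<bar>
        \<le> bessel_weight \<nu> m * T ^ m"
    proof (intro always_eventually allI)
      fix n m
      have "\<bar>a n m\<bar> * (bessel_weight \<nu> m * \<bar>t n\<bar> ^ m) \<le> 1 * (bessel_weight \<nu> m * T ^ m)"
        using T[of n] assms(4) bessel_weight_pos[OF assms(1), of m] \<open>T \<ge> 0\<close>
        by (intro mult_mono power_mono) auto
      then show "\<bar>a n m * (bessel_weight \<nu> m * (- t n) ^ m)\<bar> \<le> bessel_weight \<nu> m * T ^ m"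
        using bessel_weight_pos[OF assms(1), of m] by (simp add: abs_mult power_abs)
    qed
    show "summable (\<lambda>m. bessel_weight \<nu> m * T ^ m)"
      by (rule bessel_weight_summable[OF assms(1)])
  qed
qed

text \<open>Scaling the argument by the degree turns each coefficient into that of
  \<open>bessel_F\<close> times a binomial ratio.\<close>

lemma laguerre_tendsto_bessel_F:
  assumes "\<nu> > -1" "t \<longlonglongrightarrow> l" "filterlim N at_top sequentially"
  shows "(\<lambda>n. poly (laguerre (N n) \<nu>) (t n / real (N n))) \<longlonglongrightarrow> bessel_F \<nu> l"
proof -
  have "poly (laguerre (N n) \<nu>) (t n / real (N n)) = (\<Sum>m. real (N n choose m) * fact m
      / real (N n) ^ m * (bessel_weight \<nu> m * (- t n) ^ m))" for n
    unfolding poly_eq_suminf coeff_laguerre bessel_weight_def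
    by (intro suminf_cong) (simp add: power_divide power_minus[of "t n"] mult_ac)
  then show ?thesis
    using bessel_F_tannery[OF assms(1,2) filterlim_compose[OF choose_ratio_tendsto_1 assms(3)]]
      choose_ratio_le_1 by simp
qed

text \<open>Differentiation shifts the binomial ratios by one index and the weights to the next
  order, so the same domination applies directly to the derivatives.\<close>

lemma pderiv_laguerre_tendsto_bessel_F:
  assumes "\<nu> > -1" "t \<longlonglongrightarrow> l" "filterlim N at_top sequentially"
  shows "(\<lambda>n. poly (pderiv (laguerre (N n) \<nu>)) (t n / real (N n)) / real (N n)) \<longlonglongrightarrow> - bessel_F (\<nu> + 1) l"
proof -
  let ?a = "\<lambda>n m. real (N n choose Suc m) * fact (Suc m) / real (N n) ^ Suc m"
  have "poly (pderiv (laguerre (N n) \<nu>)) (t n / real (N n)) / real (N n)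
      = - (\<Sum>m. ?a n m * (bessel_weight (\<nu> + 1) m * (- t n) ^ m))" for n
  proof -
    have 1: "coeff (pderiv (laguerre (N n) \<nu>)) m * (t n / real (N n)) ^ m / real (N n)
        = - (?a n m * (bessel_weight (\<nu> + 1) m * (- t n) ^ m))" for m
      unfolding coeff_pderiv coeff_laguerre bessel_weight_def
      by (simp add: power_divide power_minus[of "t n"] add_ac mult_ac)
    have 2: "(\<lambda>m. coeff (pderiv (laguerre (N n) \<nu>)) m * (t n / real (N n)) ^ m)
        sums poly (pderiv (laguerre (N n) \<nu>)) (t n / real (N n))"
      unfolding poly_altdef by (rule sums_finite) (auto simp: coeff_eq_0)
    show ?thesis
      using sums_minus[OF sums_divide[OF 2, of "real (N n)"]] unfolding 1
      by (simp add: sums_iff minus_equation_iff[of _ "suminf _"])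
  qed
  then show ?thesis
    using tendsto_minus[OF bessel_F_tannery[of "\<nu> + 1", OF _ assms(2)
      filterlim_compose[OF choose_ratio_tendsto_1[of "Suc _"] assms(3)]]]
      choose_ratio_le_1[of _ "Suc _"] assms(1) by simp
qed

subsection \<open>Passing to the limit\<close>

text \<open>Termwise, \<open>2 * sqrt s * s ^ m \<le> (m + 1) * s ^ m + s ^ (m + 1) / (m + 1)\<close>, and both
  series on the right are dominated by that of \<open>bessel_F \<nu> (- s)\<close>.\<close>

lemma bessel_F_ratio_decay:
  assumes "\<nu> > -1" "s \<ge> 0"
  shows "2 * sqrt s * bessel_F (\<nu> + 1) (- s) \<le> (2 + 1 / (\<nu> + 1)) * bessel_F \<nu> (- s)"
proof -
  define w where "w = bessel_weight (\<nu> + 1)"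
  define v where "v = bessel_weight \<nu>"
  have wp: "w m > 0" and vp: "v m > 0" for m
    using assms by (auto simp: w_def v_def intro: bessel_weight_pos)
  have v: "v m = (real m + \<nu> + 1) * w m" for m
    using bessel_weight_order_Suc[OF assms(1)] by (simp add: v_def w_def)
  have vS: "v (Suc m) = w m / real (Suc m)" for m
    using bessel_weight_Suc[of m \<nu>] by (simp add: v_def w_def field_simps)
  have sv: "summable (\<lambda>m. v m * s ^ m)"
    unfolding v_def by (rule bessel_weight_summable[OF assms(1)])
  have sw: "summable (\<lambda>m. w m * s ^ m)"
    unfolding w_def using assms by (intro bessel_weight_summable) auto
  have sv1: "summable (\<lambda>m. v (Suc m) * s ^ Suc m)"
    using sv by (subst summable_Suc_iff)
  have F: "bessel_F \<nu> (- s) = (\<Sum>m. v m * s ^ m)" "bessel_F (\<nu> + 1) (- s) = (\<Sum>m. w m * s ^ m)"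
    by (simp_all add: bessel_F_def v_def w_def)
  have le: "2 * sqrt s * (w m * s ^ m) \<le> (1 + 1 / (\<nu> + 1)) * (v m * s ^ m) + v (Suc m) * s ^ Suc m" for m
  proof -
    have "0 \<le> (sqrt s - real (Suc m))\<^sup>2"
      by simp
    then have "2 * sqrt s * real (Suc m) \<le> real (Suc m) * real (Suc m) + s"
      using assms by (simp add: power2_diff power2_eq_square algebra_simps del: of_nat_Suc)
    then have 1: "2 * sqrt s \<le> real (Suc m) + s / real (Suc m)"
      by (simp add: field_simps)
    \<comment> \<open>For negative \<nu> the factor \<open>m + \<nu> + 1\<close> is smaller than
      \<open>m + 1\<close>; the constant \<open>1 + 1 / (\<nu> + 1)\<close> makes up for
      this.\<close>
    have "real (Suc m) \<le> (real m + \<nu> + 1) + (real m / (\<nu> + 1) + 1)"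
      using assms divide_nonneg_nonneg[of "real m" "\<nu> + 1"] by linarith
    also have "\<dots> = (1 + 1 / (\<nu> + 1)) * (real m + \<nu> + 1)"
      using assms by (simp add: field_simps)
    finally have "2 * sqrt s \<le> (1 + 1 / (\<nu> + 1)) * (real m + \<nu> + 1) + s / real (Suc m)"
      using 1 by linarith
    then have "2 * sqrt s * (w m * s ^ m)
        \<le> ((1 + 1 / (\<nu> + 1)) * (real m + \<nu> + 1) + s / real (Suc m)) * (w m * s ^ m)"
      using wp[of m] assms by (intro mult_right_mono) auto
    also have "\<dots> = (1 + 1 / (\<nu> + 1)) * (v m * s ^ m) + v (Suc m) * s ^ Suc m"
    proof -
      have "(K * n + s / r) * (x * q) = K * (n * x * q) + x / r * (s * q)" for K n r x q :: real
        by (simp add: divide_inverse algebra_simps)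
      then show ?thesis
        unfolding v[of m] vS power_Suc by blast
    qed
    finally show ?thesis .
  qed
  have "2 * sqrt s * bessel_F (\<nu> + 1) (- s) = (\<Sum>m. 2 * sqrt s * (w m * s ^ m))"
    unfolding F by (rule suminf_mult[symmetric, OF sw])
  also have "\<dots> \<le> (\<Sum>m. (1 + 1 / (\<nu> + 1)) * (v m * s ^ m) + v (Suc m) * s ^ Suc m)"
    using le by (intro suminf_le summable_add summable_mult sv sw sv1) auto
  also have "\<dots> = (1 + 1 / (\<nu> + 1)) * bessel_F \<nu> (- s) + (bessel_F \<nu> (- s) - v 0)"
    unfolding F suminf_add[OF summable_mult[OF sv] sv1, symmetric]
    by (simp only: suminf_mult[OF sv] suminf_split_head[OF sv] power_0 mult_1_right)
  also have "\<dots> \<le> (2 + 1 / (\<nu> + 1)) * bessel_F \<nu> (- s)"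
    using vp[of 0] unfolding distrib_right by simp
  finally show ?thesis .
qed

text \<open>Here \<open>y n\<close> lists the reciprocal roots of the rescaled polynomial of degree
  \<open>N n\<close>, padded with zeros. Reciprocals keep the limits finite: a root that escapes to
  infinity shows up as \<open>Y k = 0\<close>, which is excluded only later.\<close>

locale laguerre_limit =
  fixes \<nu> :: real and N :: "nat \<Rightarrow> nat" and y :: "nat \<Rightarrow> nat \<Rightarrow> real" and Y :: "nat \<Rightarrow> real"
  assumes order: "\<nu> > -1"
    and degree_lim: "filterlim N at_top sequentially"
    and root_pos: "k < N n \<Longrightarrow> y n k > 0"
    and root_beyond: "k \<ge> N n \<Longrightarrow> y n k = 0"
    and root_decreasing: "Suc k < N n \<Longrightarrow> y n (Suc k) < y n k"
    and factorization:
      "poly (laguerre (N n) \<nu>) (t / real (N n)) = (\<Prod>k<N n. 1 - t * y n k) / Gamma (\<nu> + 1)"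
    and degree_pos: "N n > 0"
    and root_sum: "(\<Sum>k<N n. y n k) = 1 / (\<nu> + 1)"
    and root_lim: "(\<lambda>n. y n k) \<longlonglongrightarrow> Y k"
begin

lemma y_nonneg: "y n k \<ge> 0"
  using root_pos[of k n] root_beyond[of n k] by (cases "k < N n") auto

lemma y_antimono: "i \<le> j \<Longrightarrow> y n j \<le> y n i"
proof (rule lift_Suc_antimono_le[of "y n"])
  show "y n (Suc k) \<le> y n k" for k
    using root_decreasing[of k n] root_beyond[of n "Suc k"] y_nonneg[of n k]
    by (cases "Suc k < N n") auto
qed

lemma y_partial_sum: "(\<Sum>k<K. y n k) \<le> 1 / (\<nu> + 1)"
proof -
  have "(\<Sum>k<K. y n k) \<le> (\<Sum>k<max K (N n). y n k)"
    by (intro sum_mono2) (auto simp: y_nonneg)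
  also have "\<dots> = (\<Sum>k<N n. y n k)"
    by (intro sum.mono_neutral_right) (auto simp: root_beyond)
  finally show ?thesis
    by (simp add: root_sum)
qed

text \<open>The first \<open>k + 1\<close> terms are all at least \<open>y n k\<close>, and their
  sum is bounded independently of \<open>n\<close>.\<close>

lemma y_le: "y n k \<le> 1 / (\<nu> + 1) / real (Suc k)"
proof -
  have "real (Suc k) * y n k = (\<Sum>i<Suc k. y n k)"
    by simp
  also have "\<dots> \<le> (\<Sum>i<Suc k. y n i)"
    by (intro sum_mono y_antimono) auto
  also have "\<dots> \<le> 1 / (\<nu> + 1)"
    by (rule y_partial_sum)
  finally show ?thesis
    by (simp add: pos_le_divide_eq mult.commute del: of_nat_Suc divide_divide_eq_left)
qed

lemma Y_nonneg: "Y k \<ge> 0"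
  by (rule LIMSEQ_le_const[OF root_lim]) (auto simp: y_nonneg)

lemma Y_antimono: "i \<le> j \<Longrightarrow> Y j \<le> Y i"
  by (rule LIMSEQ_le[OF root_lim root_lim]) (auto simp: y_antimono)

lemma Y_partial_sum: "(\<Sum>k<K. Y k) \<le> 1 / (\<nu> + 1)"
  by (rule LIMSEQ_le_const2[OF tendsto_sum[OF root_lim]]) (use y_partial_sum in blast)

lemma Y_summable: "summable Y"
  by (rule bounded_imp_summable[OF Y_nonneg])
    (use Y_partial_sum[of "Suc _"] in \<open>simp only: lessThan_Suc_atMost\<close>)

text \<open>Termwise limits preserve only this inequality, since mass could escape to large indices;
  equality needs the decay argument in \<open>Y_suminf\<close>.\<close>

lemma Y_suminf_le: "suminf Y \<le> 1 / (\<nu> + 1)"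
  by (rule suminf_le_const[OF Y_summable Y_partial_sum])

lemma degree_eventually_gt: "\<forall>\<^sub>F n in sequentially. k < N n"
  by (rule eventually_compose_filterlim[OF eventually_gt_at_top degree_lim])

text \<open>The compensating term \<open>1 / (\<nu> + 1)\<close> makes the terms quadratic in the reciprocal roots,
  which are \<open>O(1 / k)\<close> uniformly; hence the limit may be taken termwise.\<close>

lemma bessel_F_quotient_raw:
  assumes t: "\<And>k. 1 - t * Y k \<noteq> 0"
  shows "bessel_F (\<nu> + 1) t
      = bessel_F \<nu> t * (1 / (\<nu> + 1) + (\<Sum>k. t * (Y k)\<^sup>2 / (1 - t * Y k)))"
    and "summable (\<lambda>k. t * (Y k)\<^sup>2 / (1 - t * Y k))"
proof -
  define B where "B = 1 / (\<nu> + 1)"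
  have B: "B > 0"
    using order by (simp add: B_def)
  obtain K :: nat where K: "real K > 2 * (\<bar>t\<bar> * B)"
    using reals_Archimedean2 by blast
  have large: "\<bar>1 - t * y n k\<bar> \<ge> 1 / 2" if "k \<ge> K" for n k
  proof -
    have "\<bar>t\<bar> * y n k \<le> \<bar>t\<bar> * (B / real (Suc k))"
      using y_le[of n k] by (intro mult_left_mono) (auto simp: B_def)
    also have "\<dots> \<le> 1 / 2"
      using K that by (simp add: field_simps)
    finally have "\<bar>t * y n k\<bar> \<le> 1 / 2"
      using y_nonneg[of n k] by (simp add: abs_mult)
    then show ?thesis
      by linarith
  qed
  \<comment> \<open>Indices from \<open>K\<close> on keep a distance of \<open>1 / 2\<close> for
    every \<open>n\<close>. For the finitely many others, half of the limiting distance is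
    eventually exceeded.\<close>
  define \<delta> where "\<delta> = Min (insert (1 / 2) ((\<lambda>k. \<bar>1 - t * Y k\<bar> / 2) ` {..<K}))"
  have \<delta>: "\<delta> > 0"
    unfolding \<delta>_def using t by (subst Min_gr_iff) auto
  have ev: "\<forall>\<^sub>F n in sequentially. \<forall>k. \<bar>1 - t * y n k\<bar> \<ge> \<delta>"
  proof -
    have "\<forall>\<^sub>F n in sequentially. \<forall>k\<in>{..<K}. \<bar>1 - t * y n k\<bar> > \<bar>1 - t * Y k\<bar> / 2"
    proof (intro eventually_ball_finite ballI)
      fix k
      have "(\<lambda>n. \<bar>1 - t * y n k\<bar>) \<longlonglongrightarrow> \<bar>1 - t * Y k\<bar>"
        by (intro tendsto_intros root_lim)
      then show "\<forall>\<^sub>F n in sequentially. \<bar>1 - t * y n k\<bar> > \<bar>1 - t * Y k\<bar> / 2"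
        by (rule order_tendstoD) (use t[of k] in simp)
    qed simp
    then show ?thesis
    proof eventually_elim
      case (elim n)
      show ?case
      proof
        fix k
        show "\<bar>1 - t * y n k\<bar> \<ge> \<delta>"
        proof (cases "k < K")
          case True
          then have "\<delta> \<le> \<bar>1 - t * Y k\<bar> / 2"
            unfolding \<delta>_def by (intro Min_le) auto
          then show ?thesis
            using elim True by force
        next
          case False
          have "\<delta> \<le> 1 / 2"
            unfolding \<delta>_def by (intro Min_le) auto
          then show ?thesis
            using large[of k n] False by simp
        qed
      qed
    qed
  qed
  let ?q = "\<lambda>x. t * x\<^sup>2 / (1 - t * x)"
  have q: "(\<lambda>n. ?q (y n k)) \<longlonglongrightarrow> ?q (Y k)" for k
    by (intro tendsto_intros root_lim t)
  have qb: "\<forall>\<^sub>F n in sequentially. \<forall>k. \<bar>?q (y n k)\<bar> \<le> \<bar>t\<bar> * B\<^sup>2 / \<delta> * (1 / (real (Suc k))\<^sup>2)"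
    using ev
  proof eventually_elim
    case (elim n)
    show ?case
    proof
      fix k
      have "(y n k)\<^sup>2 \<le> (B / real (Suc k))\<^sup>2"
        using y_le[of n k] y_nonneg[of n k] unfolding B_def by (intro power_mono)
      then have "\<bar>t\<bar> * (y n k)\<^sup>2 / \<bar>1 - t * y n k\<bar> \<le> \<bar>t\<bar> * (B / real (Suc k))\<^sup>2 / \<delta>"
        using elim \<delta> by (intro frac_le mult_left_mono) auto
      then show "\<bar>?q (y n k)\<bar> \<le> \<bar>t\<bar> * B\<^sup>2 / \<delta> * (1 / (real (Suc k))\<^sup>2)"
        by (simp add: abs_mult power_divide mult_ac)
    qed
  qed
  have sq: "summable (\<lambda>k. \<bar>t\<bar> * B\<^sup>2 / \<delta> * (1 / (real (Suc k))\<^sup>2))"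
    using inverse_squares_sums by (intro summable_mult) (auto simp: sums_iff add_ac)
  show "summable (\<lambda>k. ?q (Y k))"
    by (rule tannery_sequence(2)[OF q qb sq])
  have lim: "(\<lambda>n. \<Sum>k. ?q (y n k)) \<longlonglongrightarrow> (\<Sum>k. ?q (Y k))"
    by (rule tannery_sequence(1)[OF q qb sq])
  let ?L = "\<lambda>n. poly (laguerre (N n) \<nu>) (t / real (N n))"
  let ?L' = "\<lambda>n. poly (pderiv (laguerre (N n) \<nu>)) (t / real (N n)) / real (N n)"
  \<comment> \<open>The logarithmic derivative of the product is the sum of
    \<open>- y / (1 - t * y)\<close>. Writing
    \<open>y / (1 - t * y) = y + t * y\<^sup>2 / (1 - t * y)\<close> splits off the exactly known
    sum \<open>B\<close> of the reciprocal roots.\<close>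
  have log_deriv: "\<forall>\<^sub>F n in sequentially. ?L' n = - (?L n * (B + (\<Sum>k. ?q (y n k))))"
    using ev
  proof eventually_elim
    case (elim n)
    then have nz: "1 - t * y n k \<noteq> 0" for k
      using \<delta> by (metis abs_zero not_le)
    have "((\<lambda>t. \<Prod>k<N n. 1 - t * y n k) has_real_derivative
        (\<Prod>k<N n. 1 - t * y n k) * (\<Sum>k<N n. - y n k / (1 - t * y n k))) (at t)"
      by (rule has_field_derivative_prod') (use nz in \<open>auto intro!: derivative_eq_intros\<close>)
    from DERIV_cdivide[OF this, of "Gamma (\<nu> + 1)"]
    have "((\<lambda>t. poly (laguerre (N n) \<nu>) (t / real (N n))) has_real_derivative
        ?L n * (\<Sum>k<N n. - y n k / (1 - t * y n k))) (at t)"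
      unfolding factorization by simp
    moreover have "((\<lambda>t. poly (laguerre (N n) \<nu>) (t / real (N n))) has_real_derivative ?L' n) (at t)"
      using DERIV_chain2[OF poly_DERIV DERIV_cdivide[OF DERIV_ident]] by simp
    ultimately have "?L' n = ?L n * (\<Sum>k<N n. - y n k / (1 - t * y n k))"
      using DERIV_unique by blast
    also have "(\<Sum>k<N n. - y n k / (1 - t * y n k)) = - (\<Sum>k<N n. y n k + ?q (y n k))"
      unfolding sum_negf[symmetric] using nz
      by (intro sum.cong) (auto simp: field_simps power2_eq_square)
    also have "(\<Sum>k<N n. y n k + ?q (y n k)) = B + (\<Sum>k<N n. ?q (y n k))"
      unfolding sum.distrib root_sum B_def ..
    also have "(\<Sum>k<N n. ?q (y n k)) = (\<Sum>k. ?q (y n k))"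
      by (rule suminf_finite[symmetric]) (auto simp: root_beyond)
    finally show ?case
      unfolding mult_minus_right .
  qed
  have "(\<lambda>n. - (?L n * (B + (\<Sum>k. ?q (y n k))))) \<longlonglongrightarrow> - (bessel_F \<nu> t * (B + (\<Sum>k. ?q (Y k))))"
    by (intro tendsto_intros lim laguerre_tendsto_bessel_F order degree_lim)
  moreover have "(\<lambda>n. - (?L n * (B + (\<Sum>k. ?q (y n k))))) \<longlonglongrightarrow> - bessel_F (\<nu> + 1) t"
    by (rule Lim_transform_eventually[OF
        pderiv_laguerre_tendsto_bessel_F[OF order tendsto_const degree_lim] log_deriv])
  ultimately have "- (bessel_F \<nu> t * (B + (\<Sum>k. ?q (Y k)))) = - bessel_F (\<nu> + 1) t"
    by (rule LIMSEQ_unique)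
  then show "bessel_F (\<nu> + 1) t = bessel_F \<nu> t * (1 / (\<nu> + 1) + (\<Sum>k. ?q (Y k)))"
    by (simp only: B_def neg_equal_iff_equal)
qed

lemma inverse_root_lim:
  assumes "Y k > 0"
  shows "(\<lambda>n. 1 / y n k) \<longlonglongrightarrow> 1 / Y k"
  using assms by (intro tendsto_intros root_lim) auto

text \<open>The points \<open>1 / y n k\<close> are roots of the approximating polynomials and
  converge to \<open>1 / Y k\<close>, so convergence along moving arguments applies.\<close>

lemma bessel_F_zero:
  assumes "Y k > 0"
  shows "bessel_F \<nu> (1 / Y k) = 0"
proof -
  have "\<forall>\<^sub>F n in sequentially. poly (laguerre (N n) \<nu>) (1 / y n k / real (N n)) = 0"
    using degree_eventually_gt[of k]
  proof eventually_elim
    case (elim n)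
    then have "(\<Prod>j<N n. 1 - 1 / y n k * y n j) = 0"
      using root_pos[OF elim] by (intro prod_zero) (auto intro!: bexI[of _ k])
    then show ?case
      unfolding factorization by simp
  qed
  with laguerre_tendsto_bessel_F[OF order inverse_root_lim[OF assms] degree_lim]
  have "(\<lambda>n. 0 :: real) \<longlonglongrightarrow> bessel_F \<nu> (1 / Y k)"
    by (rule Lim_transform_eventually)
  then show ?thesis
    by (simp add: LIMSEQ_const_iff)
qed

text \<open>If two consecutive reciprocal roots had the same positive limit, Rolle's theorem would make
  that limit a common zero of \<open>bessel_F \<nu>\<close> and its derivative.\<close>

lemma Y_strict:
  assumes "Y k > 0"
  shows "Y (Suc k) < Y k"
proof (rule ccontr)
  assume "\<not> Y (Suc k) < Y k"
  with Y_antimono[of k "Suc k"] have eq: "Y (Suc k) = Y k"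
    by simp
  let ?P = "\<lambda>n t. poly (laguerre (N n) \<nu>) (t / real (N n))"
  let ?P' = "\<lambda>n t. poly (pderiv (laguerre (N n) \<nu>)) (t / real (N n)) / real (N n)"
  have "\<exists>w. Suc k < N n \<longrightarrow> 1 / y n k \<le> w \<and> w \<le> 1 / y n (Suc k) \<and> ?P' n w = 0" for n
  proof (cases "Suc k < N n")
    case True
    have p: "y n (Suc k) > 0" "y n k > 0"
      using True by (auto intro: root_pos)
    have zero: "?P n (1 / y n j) = 0" if "j < N n" for j
    proof -
      have "(\<Prod>i<N n. 1 - 1 / y n j * y n i) = 0"
        using root_pos[OF that] that by (intro prod_zero) (auto intro!: bexI[of _ j])
      then show ?thesis
        unfolding factorization by simp
    qed
    have lt: "1 / y n k < 1 / y n (Suc k)"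
      using root_decreasing[OF True] p by (simp add: field_simps)
    have d: "(?P n has_real_derivative ?P' n t) (at t)" for t
      using DERIV_chain2[OF poly_DERIV DERIV_cdivide[OF DERIV_ident]] by simp
    have "continuous_on {1 / y n k..1 / y n (Suc k)} (?P n)"
      by (intro continuous_intros) (use degree_pos[of n] in auto)
    from Rolle_deriv[OF lt _ this, of "\<lambda>t. (*) (?P' n t)"] zero[of k] zero[of "Suc k"] True d
    obtain w where "1 / y n k < w" "w < 1 / y n (Suc k)" "(*) (?P' n w) = (\<lambda>v. 0)"
      unfolding has_field_derivative_def by auto
    then show ?thesis
      by (intro exI[of _ w]) (auto dest: fun_cong[of _ _ 1])
  qed auto
  then obtain w where w: "\<And>n. Suc k < N n \<Longrightarrow> 1 / y n k \<le> w n"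
    "\<And>n. Suc k < N n \<Longrightarrow> w n \<le> 1 / y n (Suc k)" "\<And>n. Suc k < N n \<Longrightarrow> ?P' n (w n) = 0"
    by metis
  have l2: "(\<lambda>n. 1 / y n (Suc k)) \<longlonglongrightarrow> 1 / Y k"
    using inverse_root_lim[of "Suc k"] assms eq by simp
  have "w \<longlonglongrightarrow> 1 / Y k"
    by (rule tendsto_sandwich[OF _ _ inverse_root_lim[OF assms] l2];
        rule eventually_mono[OF degree_eventually_gt[of "Suc k"]]) (use w in auto)
  from pderiv_laguerre_tendsto_bessel_F[OF order this degree_lim]
  have "(\<lambda>n. 0 :: real) \<longlonglongrightarrow> - bessel_F (\<nu> + 1) (1 / Y k)"
    by (rule Lim_transform_eventually)
      (use eventually_mono[OF degree_eventually_gt[of "Suc k"] w(3)] in auto)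
  then have "bessel_F (\<nu> + 1) (1 / Y k) = 0"
    by (simp add: LIMSEQ_const_iff)
  with bessel_F_no_common_zero[OF order bessel_F_zero[OF assms]] show False
    by simp
qed

text \<open>Since \<open>Y\<close> is summable, the compensation can be undone. The constant
  \<open>1 / (\<nu> + 1) - suminf Y\<close> measures the mass lost in the limit.\<close>

lemma bessel_F_quotient_defect:
  assumes t: "\<And>k. 1 - t * Y k \<noteq> 0"
  shows "bessel_F (\<nu> + 1) t
      = bessel_F \<nu> t * (1 / (\<nu> + 1) - suminf Y + (\<Sum>k. Y k / (1 - t * Y k)))"
    and "summable (\<lambda>k. Y k / (1 - t * Y k))"
proof -
  have "Y k / (1 - t * Y k) = Y k + t * (Y k)\<^sup>2 / (1 - t * Y k)" for k
    using t[of k] by (simp add: field_simps power2_eq_square)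
  then show "summable (\<lambda>k. Y k / (1 - t * Y k))"
    and "bessel_F (\<nu> + 1) t
      = bessel_F \<nu> t * (1 / (\<nu> + 1) - suminf Y + (\<Sum>k. Y k / (1 - t * Y k)))"
    using bessel_F_quotient_raw[OF t] Y_summable
    by (auto intro!: summable_add simp: suminf_add[symmetric])
qed

text \<open>No mass escapes in the limit: the defect is a lower bound for
  \<open>bessel_F (\<nu> + 1) (- s) / bessel_F \<nu> (- s)\<close>, which tends to \<open>0\<close> as \<open>s\<close> grows.\<close>

lemma Y_suminf: "suminf Y = 1 / (\<nu> + 1)"
proof (rule ccontr)
  define c where "c = 1 / (\<nu> + 1) - suminf Y"
  define C where "C = 2 + 1 / (\<nu> + 1)"
  assume "suminf Y \<noteq> 1 / (\<nu> + 1)"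
  with Y_suminf_le have c: "c > 0"
    by (simp add: c_def)
  have C: "C > 0"
    using order by (simp add: C_def add_pos_pos)
  \<comment> \<open>With \<open>sqrt s = C / c\<close> the lower bound becomes \<open>2 * C\<close>
    times \<open>bessel_F \<nu> (- s)\<close>, while the decay estimate allows only \<open>C\<close>
    times it.\<close>
  define s where "s = (C / c)\<^sup>2"
  have s: "s > 0" "sqrt s = C / c"
    using c C by (simp_all add: s_def)
  have nz: "1 - (- s) * Y k > 0" for k
    using s Y_nonneg[of k] by (simp add: add_pos_nonneg)
  have F: "bessel_F \<nu> (- s) > 0"
    using s by (intro bessel_F_nonpos_pos order) auto
  have "0 \<le> (\<Sum>k. Y k / (1 - (- s) * Y k))"
    using nz Y_nonneg by (intro suminf_nonneg bessel_F_quotient_defect(2)) (auto simp: less_imp_le less_imp_neq[symmetric])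
  then have "bessel_F \<nu> (- s) * c \<le> bessel_F (\<nu> + 1) (- s)"
    using bessel_F_quotient_defect(1)[of "- s"] nz F
    by (simp add: c_def less_imp_neq[symmetric])
  then have "2 * sqrt s * (bessel_F \<nu> (- s) * c) \<le> 2 * sqrt s * bessel_F (\<nu> + 1) (- s)"
    using s c C by (intro mult_left_mono) auto
  also have "\<dots> \<le> C * bessel_F \<nu> (- s)"
    unfolding C_def using s by (intro bessel_F_ratio_decay order) auto
  finally show False
    using F c C s(2) by (simp add: field_simps)
qed

lemma bessel_F_quotient:
  assumes t: "\<And>k. 1 - t * Y k \<noteq> 0"
  shows "bessel_F (\<nu> + 1) t = bessel_F \<nu> t * (\<Sum>k. Y k / (1 - t * Y k))"
  using bessel_F_quotient_defect(1)[OF t] Y_suminf by simp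

text \<open>With finitely many zeros, \<open>s * bessel_F (\<nu> + 1) (- s) / bessel_F \<nu> (- s)\<close> would stay bounded,
  which contradicts the decay of the next quotient through the three-term recurrence.\<close>

lemma Y_pos: "Y k > 0"
proof (rule ccontr)
  assume "\<not> Y k > 0"
  then have Yk: "Y j = 0" if "j \<ge> k" for j
    using Y_antimono[OF that] Y_nonneg[of j] by simp
  define C where "C = 2 + 1 / (\<nu> + 1 + 1)"
  \<comment> \<open>The bound on the finite sum, the recurrence and the decay estimate at
    \<open>- u\<^sup>2\<close> combine to \<open>u * u \<le> a + b * u\<close>; the choice
    \<open>u = a + b + 1\<close> violates this.\<close>
  define a b where "a = real k * (\<nu> + 1)" and "b = real k * C / 2"
  have C: "C > 0" "a \<ge> 0" "b \<ge> 0"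
    using order by (auto simp: C_def a_def b_def intro!: add_pos_pos)
  define u where "u = a + b + 1"
  have u: "u > 0"
    using C by (simp add: u_def)
  let ?s = "u\<^sup>2"
  let ?F = "\<lambda>i. bessel_F (\<nu> + i) (- ?s)"
  have F: "?F 0 > 0" "?F 1 > 0" "?F 2 > 0"
    using order by (auto intro!: bessel_F_nonpos_pos)
  have nz: "1 - (- ?s) * Y k > 0" for k
    using Y_nonneg[of k] by (simp add: add_pos_nonneg)
  have "(\<Sum>j. Y j / (1 - (- ?s) * Y j)) = (\<Sum>j<k. Y j / (1 - (- ?s) * Y j))"
    by (rule suminf_finite) (use Yk in auto)
  \<comment> \<open>Each term \<open>Y / (1 + s * Y)\<close> is at most \<open>1 / s\<close>,
    whatever the size of \<open>Y\<close>.\<close>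
  also have "\<dots> \<le> (\<Sum>j<k. 1 / ?s)"
    using nz u Y_nonneg by (intro sum_mono) (simp add: divide_le_eq le_divide_eq mult_ac)
  also have "\<dots> = real k / ?s"
    by simp
  finally have "?F 0 * (\<Sum>j. Y j / (1 - (- ?s) * Y j)) \<le> ?F 0 * (real k / ?s)"
    using F by (intro mult_left_mono) auto
  moreover have "?F 1 = ?F 0 * (\<Sum>j. Y j / (1 - (- ?s) * Y j))"
    using bessel_F_quotient[of "- ?s"] nz by (simp add: less_imp_neq[symmetric])
  ultimately have "?F 1 \<le> ?F 0 * (real k / ?s)"
    by simp
  then have "?s * ?F 1 \<le> real k * ?F 0"
    using u by (simp add: field_simps)
  also have "?F 0 = (\<nu> + 1) * ?F 1 + ?s * ?F 2"
    using bessel_F_recurrence[OF order, of "- ?s"] by simp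
  finally have "?s * ?F 1 \<le> a * ?F 1 + real k * u * (u * ?F 2)"
    by (simp add: a_def algebra_simps power2_eq_square)
  also have "2 * u * ?F 2 \<le> C * ?F 1"
    using bessel_F_ratio_decay[of "\<nu> + 1" ?s] order u by (simp add: C_def add_ac)
  then have "real k * u * (u * ?F 2) \<le> real k * u * (C * ?F 1 / 2)"
    using u by (intro mult_left_mono) auto
  finally have "?s * ?F 1 \<le> (a + b * u) * ?F 1"
    by (simp add: b_def algebra_simps)
  then have "u * u \<le> a + b * u"
    using F by (simp add: power2_eq_square)
  moreover have "u * u = a * u + b * u + u"
    by (simp add: u_def algebra_simps)
  moreover have "a * 1 \<le> a * u"
    using C by (intro mult_left_mono) (auto simp: u_def)
  ultimately show False
    using u by simp
qed

lemma outside_range_nonzero: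
  assumes "t \<notin> range (\<lambda>k. 1 / Y k)"
  shows "1 - t * Y k \<noteq> 0"
proof
  assume "1 - t * Y k = 0"
  then have "t = 1 / Y k"
    using Y_pos[of k] by (simp add: nonzero_eq_divide_eq less_imp_neq[symmetric])
  then show False
    using assms by blast
qed

text \<open>At a further zero the quotient formula would be valid and would make the next order
  vanish there too.\<close>

lemma bessel_F_zero_iff: "bessel_F \<nu> t = 0 \<longleftrightarrow> t \<in> range (\<lambda>k. 1 / Y k)"
proof
  assume z: "bessel_F \<nu> t = 0"
  show "t \<in> range (\<lambda>k. 1 / Y k)"
  proof (rule ccontr)
    assume "t \<notin> range (\<lambda>k. 1 / Y k)"
    then have "1 - t * Y k \<noteq> 0" for k
      by (rule outside_range_nonzero)
    from bessel_F_quotient[OF this] bessel_F_no_common_zero[OF order z] z show False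
      by simp
  qed
qed (use bessel_F_zero Y_pos in auto)

end

theorem bessel_F_partial_fractions:
  assumes "\<nu> > -1"
  obtains x :: "nat \<Rightarrow> real" where "strict_mono x" "\<And>k. x k > 0"
    "\<And>t. bessel_F \<nu> t = 0 \<longleftrightarrow> t \<in> range x" "summable (\<lambda>k. 1 / x k)"
    "\<And>t. t \<notin> range x \<Longrightarrow> bessel_F (\<nu> + 1) t / bessel_F \<nu> t = (\<Sum>k. 1 / (x k - t))"
proof -
  \<comment> \<open>Degree \<open>Suc n\<close> keeps the scaling factor nonzero.\<close>
  have "\<exists>y. (\<forall>k<Suc n. y k > 0) \<and> (\<forall>k. Suc k < Suc n \<longrightarrow> y (Suc k) < y k)
      \<and> (\<forall>s. poly (laguerre (Suc n) \<nu>) s = (\<Prod>k<Suc n. 1 - s * y k) / Gamma (\<nu> + 1))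
      \<and> (\<Sum>k<Suc n. y k) = real (Suc n) / (\<nu> + 1)" for n
    by (rule laguerre_factorization[OF assms, of "Suc n"]) blast
  then obtain x :: "nat \<Rightarrow> nat \<Rightarrow> real" where x: "\<And>n k. k < Suc n \<Longrightarrow> x n k > 0"
    "\<And>n k. Suc k < Suc n \<Longrightarrow> x n (Suc k) < x n k"
    "\<And>n s. poly (laguerre (Suc n) \<nu>) s = (\<Prod>k<Suc n. 1 - s * x n k) / Gamma (\<nu> + 1)"
    "\<And>n. (\<Sum>k<Suc n. x n k) = real (Suc n) / (\<nu> + 1)"
    by metis
  define y where "y = (\<lambda>n k. if k < Suc n then x n k / real (Suc n) else 0)"
  have y_nonneg: "y n k \<ge> 0" for n k
    using x(1)[of k n] by (auto simp: y_def less_imp_le)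
  have ysum: "(\<Sum>k<Suc n. y n k) = 1 / (\<nu> + 1)" for n
  proof -
    have "(\<Sum>k<Suc n. y n k) = (\<Sum>k<Suc n. x n k) / real (Suc n)"
      unfolding sum_divide_distrib by (intro sum.cong) (auto simp: y_def)
    then show ?thesis
      unfolding x(4) by simp
  qed
  have y_le: "norm (y n k) \<le> 1 / (\<nu> + 1)" for n k
  proof (cases "k < Suc n")
    case True
    have "y n k \<le> (\<Sum>k<Suc n. y n k)"
      by (rule member_le_sum) (use True y_nonneg in auto)
    then show ?thesis
      using ysum y_nonneg[of n k] by simp
  next
    case False
    then show ?thesis
      using assms by (simp add: y_def)
  qed
  \<comment> \<open>A diagonal argument on the uniformly bounded rows yields one subsequence that
    works for all \<open>k\<close> at once.\<close>
  obtain r where r: "strict_mono r" "\<And>k. \<exists>l. (\<lambda>n. y (r n) k) \<longlonglongrightarrow> l"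
    by (rule function_convergent_subsequence[of UNIV y "1 / (\<nu> + 1)"]) (use y_le in auto)
  then obtain Y where Y: "\<And>k. (\<lambda>n. y (r n) k) \<longlonglongrightarrow> Y k"
    by metis
  interpret laguerre_limit \<nu> "\<lambda>n. Suc (r n)" "\<lambda>n. y (r n)" Y
  proof
    show "filterlim (\<lambda>n. Suc (r n)) at_top sequentially"
      by (rule filterlim_compose[OF filterlim_Suc filterlim_subseq[OF r(1)]])
    show "y (r n) k > 0" if "k < Suc (r n)" for n k
      using x(1)[OF that] that by (simp add: y_def)
    show "y (r n) (Suc k) < y (r n) k" if "Suc k < Suc (r n)" for n k
      using x(2)[OF that] that by (auto simp: y_def divide_strict_right_mono)
    show "poly (laguerre (Suc (r n)) \<nu>) (t / real (Suc (r n)))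
        = (\<Prod>k<Suc (r n). 1 - t * y (r n) k) / Gamma (\<nu> + 1)" for n t
      unfolding x(3) by (intro arg_cong2[of _ _ _ _ "(/)"] prod.cong) (auto simp: y_def)
  qed (use assms ysum Y in \<open>auto simp: y_def\<close>)
  show ?thesis
  proof (rule that[of "\<lambda>k. 1 / Y k"])
    show "strict_mono (\<lambda>k. 1 / Y k)"
      using Y_pos Y_strict by (intro strict_monoI_Suc) (auto simp: divide_strict_left_mono)
    show "1 / Y k > 0" for k
      using Y_pos by simp
    show "bessel_F \<nu> t = 0 \<longleftrightarrow> t \<in> range (\<lambda>k. 1 / Y k)" for t
      by (rule bessel_F_zero_iff)
    show "summable (\<lambda>k. 1 / (1 / Y k))"
      using Y_summable by simp
    show "bessel_F (\<nu> + 1) t / bessel_F \<nu> t = (\<Sum>k. 1 / (1 / Y k - t))"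
      if t: "t \<notin> range (\<lambda>k. 1 / Y k)" for t
    proof -
      have "1 - t * Y k \<noteq> 0" for k
        using t by (rule outside_range_nonzero)
      from bessel_F_quotient[OF this] bessel_F_zero_iff[of t] t
      have "bessel_F (\<nu> + 1) t / bessel_F \<nu> t = (\<Sum>k. Y k / (1 - t * Y k))"
        by simp
      also have "\<dots> = (\<Sum>k. 1 / (1 / Y k - t))"
        using Y_pos by (intro suminf_cong) (simp add: field_simps less_imp_neq[symmetric])
      finally show ?thesis .
    qed
  qed
qed

subsection \<open>Zeros and logarithmic derivative of the Bessel function\<close>

lemma bessel_J_eq:
  assumes "\<nu> > -1" "x > 0"
  shows "bessel_J \<nu> x = (x / 2) powr \<nu> * bessel_F \<nu> (x\<^sup>2 / 4)"
proof -
  have "(x / 2) powr (2 * real m + \<nu>) = (x / 2) powr \<nu> * (x\<^sup>2 / 4) ^ m" for m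
  proof -
    have "(x / 2) powr (2 * real m + \<nu>) = (x / 2) powr \<nu> * (x / 2) powr real (2 * m)"
      by (simp add: powr_add)
    also have "(x / 2) powr real (2 * m) = (x / 2) ^ (2 * m)"
      using assms(2) by (intro powr_realpow) simp
    also have "\<dots> = (x\<^sup>2 / 4) ^ m"
      by (simp add: power_mult power_divide)
    finally show ?thesis .
  qed
  then have "bessel_J \<nu> x
      = (\<Sum>m. (x / 2) powr \<nu> * (bessel_weight \<nu> m * (- (x\<^sup>2 / 4)) ^ m))"
    unfolding bessel_J_def bessel_weight_def
    by (intro suminf_cong) (simp add: power_minus[of "x\<^sup>2 / 4"] mult_ac)
  also have "\<dots> = (x / 2) powr \<nu> * bessel_F \<nu> (x\<^sup>2 / 4)"
    unfolding bessel_F_def by (intro suminf_mult bessel_weight_summable assms)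
  finally show ?thesis .
qed

text \<open>The powers cancel up to a factor \<open>sqrt s / 2\<close>, which meets
  \<open>2 * sqrt s\<close> in the definition. At a zero of \<open>bessel_F p\<close> both sides are
  \<open>0\<close> by the convention for division.\<close>

lemma bessel_D_eq:
  assumes "p > -1" "s > 0"
  shows "bessel_D p s = bessel_F (p + 1) (s / 4) / (4 * bessel_F p (s / 4))"
proof -
  define P where "P = (sqrt s / 2) powr p"
  have J: "bessel_J p (sqrt s) = P * bessel_F p (s / 4)"
    "bessel_J (p + 1) (sqrt s) = P * (sqrt s / 2) * bessel_F (p + 1) (s / 4)"
    using assms by (simp_all add: bessel_J_eq P_def powr_add)
  have "P \<noteq> 0"
    using assms by (simp add: P_def)
  then show ?thesis
    using assms(2) by (simp add: bessel_D_def J)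
qed

text \<open>The map from \<open>t\<close> to \<open>2 * sqrt t\<close> carries the increasing
  enumeration of the zeros of \<open>bessel_F\<close> to that of \<open>bessel_J\<close>. Exactly
  \<open>Suc k\<close> zeros lie up to the one of index \<open>k\<close>, so the count in the
  definition singles it out.\<close>

lemma bessel_zero_eq:
  fixes x :: "nat \<Rightarrow> real"
  assumes "\<nu> > -1" "strict_mono x" "\<And>k. x k > 0"
    and zeros: "\<And>t. bessel_F \<nu> t = 0 \<longleftrightarrow> t \<in> range x"
  shows "bessel_zero \<nu> (Suc k) = 2 * sqrt (x k)"
proof -
  define z where "z = (\<lambda>k. 2 * sqrt (x k))"
  have z: "z i \<le> z j \<longleftrightarrow> i \<le> j" "z k > 0" for i j k
    using assms(3) strict_mono_less_eq[OF assms(2)] by (auto simp: z_def)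
  have J: "y > 0 \<and> bessel_J \<nu> y = 0 \<longleftrightarrow> y \<in> range z" for y
  proof (cases "y > 0")
    case True
    have "y\<^sup>2 / 4 = x k \<longleftrightarrow> y = z k" for k
    proof
      assume "y\<^sup>2 / 4 = x k"
      then have "sqrt (x k) = sqrt ((y / 2)\<^sup>2)"
        by (simp add: power_divide)
      then show "y = z k"
        using True by (simp add: z_def)
    qed (use assms(3)[of k] in \<open>simp add: z_def power_mult_distrib\<close>)
    then show ?thesis
      using True assms(1) by (auto simp: bessel_J_eq zeros)
  qed (use z(2) in fastforce)
  have card: "card {y. 0 < y \<and> y \<le> z k \<and> bessel_J \<nu> y = 0} = Suc k" for k
  proof -
    have "{y. 0 < y \<and> y \<le> z k \<and> bessel_J \<nu> y = 0} = z ` {..k}"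
    proof (intro set_eqI iffI)
      fix y assume "y \<in> {y. 0 < y \<and> y \<le> z k \<and> bessel_J \<nu> y = 0}"
      then obtain j where "y = z j" "z j \<le> z k"
        using J[of y] by auto
      then show "y \<in> z ` {..k}"
        by (simp add: z(1))
    next
      fix y assume "y \<in> z ` {..k}"
      then obtain j where j: "y = z j" "j \<le> k"
        by auto
      then show "y \<in> {y. 0 < y \<and> y \<le> z k \<and> bessel_J \<nu> y = 0}"
        using J[of y] z(1)[of j k] by simp
    qed
    moreover have "inj_on z {..k}"
      by (simp add: inj_on_def z_def strict_mono_eq[OF assms(2)])
    ultimately show ?thesis
      by (simp add: card_image)
  qed
  have "bessel_zero \<nu> (Suc k) = z k"
    unfolding bessel_zero_def
  proof (rule the_equality)
    show "z k > 0 \<and> bessel_J \<nu> (z k) = 0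
        \<and> card {y. 0 < y \<and> y \<le> z k \<and> bessel_J \<nu> y = 0} = Suc k"
      using J[of "z k"] card[of k] by simp
    fix y assume "y > 0 \<and> bessel_J \<nu> y = 0
        \<and> card {w. 0 < w \<and> w \<le> y \<and> bessel_J \<nu> w = 0} = Suc k"
    moreover from this obtain j where "y = z j"
      using J[of y] by auto
    ultimately show "y = z k"
      using card[of j] by simp
  qed
  then show ?thesis
    by (simp add: z_def)
qed

section \<open>Derivatives of the partial fraction expansion\<close>

text \<open>In \<open>1 / (a k - s) = 1 / (1 - s / a k) * (1 / a k)\<close> the first factor
  converges to \<open>1\<close>, hence is bounded.\<close>

lemma inverse_shift_summable:
  fixes a :: "nat \<Rightarrow> real"
  assumes "summable (\<lambda>k. 1 / a k)" "\<And>k. a k > 0" "s \<notin> range a"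
  shows "summable (\<lambda>k. \<bar>1 / (a k - s)\<bar>)"
proof -
  have "(\<lambda>k. 1 / (1 - s * (1 / a k))) \<longlonglongrightarrow> 1 / (1 - s * 0)"
    by (intro tendsto_intros summable_LIMSEQ_zero assms) auto
  then have "Bseq (\<lambda>k. 1 / (1 - s * (1 / a k)))"
    by (intro convergent_imp_Bseq convergentI)
  then obtain B where B: "\<And>k. \<bar>1 / (1 - s * (1 / a k))\<bar> \<le> B"
    by (auto simp: Bseq_def)
  show ?thesis
  proof (rule summable_comparison_test'[OF summable_mult[OF assms(1), of B]])
    fix k
    have "a k \<noteq> s"
      using assms(3) by auto
    have "1 - s * (1 / a k) = (a k - s) / a k"
      using assms(2)[of k] by (simp add: diff_divide_distrib)
    then have "1 / (a k - s) = 1 / (1 - s * (1 / a k)) * (1 / a k)"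
      using assms(2)[of k] by simp
    then have "\<bar>1 / (a k - s)\<bar> = \<bar>1 / (1 - s * (1 / a k))\<bar> * (1 / a k)"
      using assms(2)[of k] by (simp only: abs_mult) simp
    also have "\<dots> \<le> B * (1 / a k)"
      using B assms(2)[of k] by (intro mult_right_mono) auto
    finally show "norm \<bar>1 / (a k - s)\<bar> \<le> B * (1 / a k)"
      by simp
  qed
qed

lemma bessel_zero_squares:
  assumes "\<nu> > -1"
  defines "a \<equiv> \<lambda>k. (bessel_zero \<nu> (Suc k))\<^sup>2"
  shows "a k > 0" "summable (\<lambda>k. 1 / a k)" "bessel_F \<nu> (s / 4) = 0 \<longleftrightarrow> s \<in> range a"
    "s \<notin> range a \<Longrightarrow> bessel_F (\<nu> + 1) (s / 4) / (4 * bessel_F \<nu> (s / 4)) = (\<Sum>k. 1 / (a k - s))"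
proof -
  obtain x :: "nat \<Rightarrow> real" where x: "strict_mono x" "\<And>k. x k > 0"
    "\<And>t. bessel_F \<nu> t = 0 \<longleftrightarrow> t \<in> range x" "summable (\<lambda>k. 1 / x k)"
    "\<And>t. t \<notin> range x \<Longrightarrow> bessel_F (\<nu> + 1) t / bessel_F \<nu> t = (\<Sum>k. 1 / (x k - t))"
    using bessel_F_partial_fractions[OF assms(1)] by blast
  have a: "a = (\<lambda>k. 4 * x k)"
    unfolding a_def bessel_zero_eq[OF assms(1) x(1-3)]
    by (simp add: power_mult_distrib less_imp_le[OF x(2)])
  show "a k > 0"
    using x(2) by (simp add: a)
  show "summable (\<lambda>k. 1 / a k)"
    using summable_mult[OF x(4), of "1 / 4"] by (simp add: a)
  have range: "s / 4 \<in> range x \<longleftrightarrow> s \<in> range a"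
  proof -
    have "s / 4 = x k \<longleftrightarrow> s = 4 * x k" for k
      by auto
    then show ?thesis
      by (simp add: a image_iff)
  qed
  then show "bessel_F \<nu> (s / 4) = 0 \<longleftrightarrow> s \<in> range a"
    by (simp add: x(3))
  show "bessel_F (\<nu> + 1) (s / 4) / (4 * bessel_F \<nu> (s / 4)) = (\<Sum>k. 1 / (a k - s))"
    if "s \<notin> range a"
  proof -
    have "(\<Sum>k. 1 / (a k - s)) = (\<Sum>k. 1 / (x k - s / 4) / 4)"
      by (intro suminf_cong) (simp add: a algebra_simps)
    also have "\<dots> = (\<Sum>k. 1 / (x k - s / 4)) / 4"
      by (rule suminf_divide[OF summable_rabs_cancel[OF inverse_shift_summable[OF x(4,2)]]])
        (use that range in simp)
    finally show ?thesis
      using x(5)[of "s / 4"] that range by simp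
  qed
qed

text \<open>Near \<zeta> all differentiated series share one majorant up to constants, so the
  Weierstrass test permits termwise differentiation to any order. The conclusion covers a whole
  neighbourhood because the Taylor coefficients are later differentiated as functions of the
  centre.\<close>

lemma partial_fractions_higher_deriv:
  fixes a :: "nat \<Rightarrow> real" and f :: "real \<Rightarrow> real"
  assumes nz: "\<And>k. a k \<noteq> \<zeta>" and sum: "summable (\<lambda>k. 1 / \<bar>a k - \<zeta>\<bar>)"
    and f: "\<forall>\<^sub>F s in nhds \<zeta>. s \<notin> range a \<longrightarrow> f s = (\<Sum>k. 1 / (a k - s))"
  obtains U where "open U" "\<zeta> \<in> U"
    "\<And>r s. s \<in> U \<Longrightarrow> (\<lambda>k. 1 / (a k - s) ^ Suc r) sums ((deriv ^^ r) f s / fact r)"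
    "\<And>r s. s \<in> U \<Longrightarrow> ((\<lambda>s. (deriv ^^ r) f s / fact r) has_real_derivative
       real (Suc r) * ((deriv ^^ Suc r) f s / fact (Suc r))) (at s)"
proof -
  obtain M where M: "\<And>k. norm (1 / \<bar>a k - \<zeta>\<bar>) \<le> M" "M > 0"
    using summable_imp_Bseq[OF sum] by (auto simp: Bseq_def)
  obtain \<epsilon> where \<epsilon>: "\<epsilon> > 0" "\<And>s. dist s \<zeta> < \<epsilon> \<Longrightarrow> s \<notin> range a \<Longrightarrow> f s = (\<Sum>k. 1 / (a k - s))"
    using f by (auto simp: eventually_nhds_metric)
  \<comment> \<open>Every pole is at least \<open>1 / M\<close> away from \<zeta>, so within half of
    that radius its distance to \<open>s\<close> is at least half its distance to \<zeta>.\<close>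
  define \<delta> where "\<delta> = min \<epsilon> (1 / (2 * M))"
  define U where "U = ball \<zeta> \<delta>"
  have \<delta>: "\<delta> > 0"
    using \<epsilon> M by (simp add: \<delta>_def)
  have sep: "\<bar>a k - s\<bar> \<ge> \<bar>a k - \<zeta>\<bar> / 2" "a k \<noteq> s" if "s \<in> U" for k s
  proof -
    have "\<bar>s - \<zeta>\<bar> < 1 / (2 * M)"
      using that by (simp add: U_def \<delta>_def dist_real_def abs_minus_commute)
    moreover have "1 / M \<le> \<bar>a k - \<zeta>\<bar>"
      using M(1)[of k] M(2) nz[of k] by (simp add: field_simps)
    then have "1 / (2 * M) \<le> \<bar>a k - \<zeta>\<bar> / 2"
      by simp
    ultimately show "\<bar>a k - s\<bar> \<ge> \<bar>a k - \<zeta>\<bar> / 2"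
      using abs_triangle_ineq[of "a k - s" "s - \<zeta>"] by simp
    then show "a k \<noteq> s"
      using nz[of k] by auto
  qed
  define S where "S = (\<lambda>r s. \<Sum>k. 1 / (a k - s) ^ Suc r)"
  have bound: "norm (1 / (a k - s) ^ Suc r) \<le> 2 * (2 * M) ^ r * (1 / \<bar>a k - \<zeta>\<bar>)"
    if "s \<in> U" for r k s
  proof -
    have "1 / \<bar>a k - s\<bar> \<le> 1 / (\<bar>a k - \<zeta>\<bar> / 2)"
      using sep[OF that] nz[of k] by (intro divide_left_mono) auto
    then have 1: "1 / \<bar>a k - s\<bar> \<le> 2 * (1 / \<bar>a k - \<zeta>\<bar>)"
      by simp
    also have "\<dots> \<le> 2 * M"
      using M(1)[of k] by simp
    finally have "(1 / \<bar>a k - s\<bar>) ^ r * (1 / \<bar>a k - s\<bar>) \<le> (2 * M) ^ r * (2 * (1 / \<bar>a k - \<zeta>\<bar>))"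
      using 1 M(2) by (intro mult_mono power_mono) auto
    then show ?thesis
      by (simp add: power_divide power_abs abs_mult mult_ac)
  qed
  have summ: "summable (\<lambda>k. C * (1 / \<bar>a k - \<zeta>\<bar>))" for C
    by (rule summable_mult[OF sum])
  have S: "(\<lambda>k. 1 / (a k - s) ^ Suc r) sums S r s" if "s \<in> U" for r s
    unfolding S_def using bound[OF that]
    by (intro summable_sums summable_comparison_test'[OF summ]) auto
  have dS: "(S r has_real_derivative real (Suc r) * S (Suc r) s) (at s)" if "s \<in> U" for r s
  proof -
    have "((\<lambda>s. \<Sum>k. 1 / (a k - s) ^ Suc r) has_real_derivative
        (\<Sum>k. real (Suc r) * (1 / (a k - s) ^ Suc (Suc r)))) (at s)"
    proof (rule has_field_derivative_series'(2)[of U])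
      show "((\<lambda>s. 1 / (a k - s) ^ Suc r) has_real_derivative
          real (Suc r) * (1 / (a k - s) ^ Suc (Suc r))) (at s within U)" if "s \<in> U" for k s
      proof -
        have "((\<lambda>s. 1 / (a k - s)) has_real_derivative 1 / (a k - s)\<^sup>2) (at s within U)"
          using sep(2)[OF that, of k]
          by (auto intro!: derivative_eq_intros simp: power2_eq_square)
        from DERIV_power[OF this, of "Suc r"] show ?thesis
          by (simp add: power_divide power2_eq_square mult.assoc del: of_nat_Suc)
      qed
      show "uniformly_convergent_on U
          (\<lambda>n s. \<Sum>k<n. real (Suc r) * (1 / (a k - s) ^ Suc (Suc r)))"
      proof (rule Weierstrass_m_test'[OF _ summ])
        show "norm (real (Suc r) * (1 / (a k - s) ^ Suc (Suc r)))
            \<le> real (Suc r) * (2 * (2 * M) ^ Suc r) * (1 / \<bar>a k - \<zeta>\<bar>)" if "s \<in> U" for k s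
          using mult_left_mono[OF bound[OF that, of k "Suc r"], of "real (Suc r)"]
          unfolding norm_mult by (simp only: mult.assoc norm_of_nat)
      qed
      show "summable (\<lambda>k. 1 / (a k - \<zeta>) ^ Suc r)"
        using S[of \<zeta> r] \<delta> by (simp add: U_def sums_iff)
    qed (use that \<delta> in \<open>auto simp: U_def\<close>)
    then show ?thesis
      using suminf_mult[OF sums_summable[OF S[OF that, of "Suc r"]], of "real (Suc r)"]
      by (simp only: S_def)
  qed
  have fS: "(deriv ^^ r) f s = fact r * S r s" if "s \<in> U" for r s
    using that
  proof (induction r arbitrary: s)
    case 0
    then have "s \<notin> range a"
      using sep(2)[OF 0] by auto
    moreover have "dist s \<zeta> < \<epsilon>"
      using 0 by (simp add: U_def \<delta>_def dist_commute)
    ultimately show ?case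
      using \<epsilon>(2) by (simp add: S_def)
  next
    case (Suc r)
    have "((\<lambda>s. fact r * S r s) has_real_derivative fact r * (real (Suc r) * S (Suc r) s)) (at s)"
      by (intro DERIV_cmult dS Suc.prems)
    then have "((deriv ^^ r) f has_real_derivative fact r * (real (Suc r) * S (Suc r) s)) (at s)"
      by (rule has_field_derivative_transform_within_open[of _ _ _ U])
        (use Suc in \<open>auto simp: U_def\<close>)
    then show ?case
      by (simp add: DERIV_imp_deriv algebra_simps)
  qed
  show ?thesis
  proof (rule that[of U])
    show "open U" "\<zeta> \<in> U"
      using \<delta> by (auto simp: U_def)
    show "(\<lambda>k. 1 / (a k - s) ^ Suc r) sums ((deriv ^^ r) f s / fact r)" if "s \<in> U" for r s
      using S[OF that] fS[OF that, of r] by simp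
    show "((\<lambda>s. (deriv ^^ r) f s / fact r) has_real_derivative
       real (Suc r) * ((deriv ^^ Suc r) f s / fact (Suc r))) (at s)" if "s \<in> U" for r s
    proof -
      have "((\<lambda>s. (deriv ^^ r) f s / fact r) has_real_derivative real (Suc r) * S (Suc r) s) (at s)"
        by (rule has_field_derivative_transform_within_open[OF dS[OF that], of U])
          (use fS that in \<open>auto simp: U_def\<close>)
      then show ?thesis
        unfolding fS[OF that, of "Suc r"] by (simp del: of_nat_Suc fact_Suc)
    qed
  qed
qed

section \<open>Riccati equation and recurrence for the Taylor coefficients\<close>

text \<open>The hypothesis says that the \<open>c k\<close> behave like Taylor coefficients of
  \<open>c 0\<close> at a moving centre; the convolutions are those of its square and obey the same
  rule. In the product rule the weights \<open>j\<close> and \<open>k + 1 - j\<close> add up to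
  \<open>k + 1\<close>.\<close>

lemma convolution_derivative:
  fixes c :: "nat \<Rightarrow> real \<Rightarrow> real"
  assumes "\<And>k. (c k has_real_derivative real (Suc k) * c (Suc k) s) (at s)"
  shows "((\<lambda>s. \<Sum>j=0..k. c j s * c (k - j) s) has_real_derivative
    real (Suc k) * (\<Sum>j=0..Suc k. c j s * c (Suc k - j) s)) (at s)"
proof -
  let ?n = "Suc k"
  have "((\<lambda>s. \<Sum>j=0..k. c j s * c (k - j) s) has_real_derivative
    (\<Sum>j=0..k. real (Suc j) * c (Suc j) s * c (k - j) s
      + real (Suc (k - j)) * c (Suc (k - j)) s * c j s)) (at s)"
    by (intro DERIV_sum DERIV_mult assms)
  also have "(\<Sum>j=0..k. real (Suc j) * c (Suc j) s * c (k - j) s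
      + real (Suc (k - j)) * c (Suc (k - j)) s * c j s)
    = (\<Sum>j\<le>k. real (Suc j) * c (Suc j) s * c (?n - Suc j) s)
      + (\<Sum>j\<le>k. real (?n - j) * c j s * c (?n - j) s)"
    unfolding sum.distrib[symmetric] atLeast0AtMost
    by (intro sum.cong) (auto simp: Suc_diff_le)
  also have "(\<Sum>j\<le>k. real (Suc j) * c (Suc j) s * c (?n - Suc j) s)
      = (\<Sum>j\<le>?n. real j * c j s * c (?n - j) s)"
    by (subst sum.atMost_Suc_shift) simp
  also have "(\<Sum>j\<le>k. real (?n - j) * c j s * c (?n - j) s)
      = (\<Sum>j\<le>?n. real (?n - j) * c j s * c (?n - j) s)"
    by simp
  also have "(\<Sum>j\<le>?n. real j * c j s * c (?n - j) s)
        + (\<Sum>j\<le>?n. real (?n - j) * c j s * c (?n - j) s)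
      = real ?n * (\<Sum>j=0..?n. c j s * c (?n - j) s)"
    unfolding sum.distrib[symmetric] sum_distrib_left atLeast0AtMost
    by (intro sum.cong) (auto simp: of_nat_diff algebra_simps)
  finally show ?thesis .
qed

text \<open>Differentiating the Riccati equation once more and dividing by \<open>k + 1\<close> gives the next case of
  the recurrence.\<close>

lemma riccati_taylor_recurrence:
  fixes c :: "nat \<Rightarrow> real \<Rightarrow> real"
  assumes "open U"
    and dc: "\<And>k s. s \<in> U \<Longrightarrow> (c k has_real_derivative real (Suc k) * c (Suc k) s) (at s)"
    and riccati: "\<And>s. s \<in> U \<Longrightarrow> s * c 1 s = s * (c 0 s)\<^sup>2 - (p + 1) * c 0 s + 1 / 4"
    and "s \<in> U"
  shows "s * (real (Suc k) * c (Suc k) s)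
      = s * (\<Sum>j=0..k. c j s * c (k - j) s)
        + (case k of 0 \<Rightarrow> 1 / 4 | Suc i \<Rightarrow> \<Sum>j=0..i. c j s * c (i - j) s)
        - (real k + p + 1) * c k s"
  using assms(4)
proof (induction k arbitrary: s)
  case 0
  then show ?case
    using riccati by (simp add: power2_eq_square algebra_simps)
next
  case (Suc k)
  define C where "C = (\<lambda>k s. \<Sum>j=0..k. c j s * c (k - j) s)"
  \<comment> \<open>The constant \<open>1 / 4\<close> for \<open>k = 0\<close> and the convolution
    of index \<open>k - 1\<close> otherwise both have derivative \<open>k * C k\<close>, which
    allows a uniform induction step.\<close>
  define E where "E = (\<lambda>k s. case k of 0 \<Rightarrow> 1 / 4 | Suc i \<Rightarrow> C i s)"
  have dC: "(C k has_real_derivative real (Suc k) * C (Suc k) s) (at s)" for k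
    unfolding C_def by (rule convolution_derivative[OF dc[OF Suc.prems]])
  have dE: "(E k has_real_derivative real k * C k s) (at s)"
    using dC[of "k - 1"] by (cases k) (auto simp: E_def)
  have "((\<lambda>s. s * (real (Suc k) * c (Suc k) s)) has_real_derivative
      1 * (real (Suc k) * c (Suc k) s)
        + real (Suc k) * (real (Suc (Suc k)) * c (Suc (Suc k)) s) * s) (at s)"
    by (intro DERIV_mult DERIV_ident DERIV_cmult dc Suc.prems)
  moreover have "((\<lambda>s. s * (real (Suc k) * c (Suc k) s)) has_real_derivative
      1 * C k s + real (Suc k) * C (Suc k) s * s + real k * C k s
        - (real k + p + 1) * (real (Suc k) * c (Suc k) s)) (at s)"
  proof (rule has_field_derivative_transform_within_open[OF _ assms(1) Suc.prems])
    show "((\<lambda>s. s * C k s + E k s - (real k + p + 1) * c k s) has_real_derivative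
      1 * C k s + real (Suc k) * C (Suc k) s * s + real k * C k s
        - (real k + p + 1) * (real (Suc k) * c (Suc k) s)) (at s)"
      by (intro DERIV_add DERIV_diff DERIV_mult DERIV_ident DERIV_cmult dc dC dE Suc.prems)
    show "s * C k s + E k s - (real k + p + 1) * c k s = s * (real (Suc k) * c (Suc k) s)"
      if "s \<in> U" for s
      using Suc.IH[OF that] by (simp add: C_def E_def split: nat.split)
  qed
  ultimately have "1 * (real (Suc k) * c (Suc k) s)
        + real (Suc k) * (real (Suc (Suc k)) * c (Suc (Suc k)) s) * s
      = 1 * C k s + real (Suc k) * C (Suc k) s * s + real k * C k s
        - (real k + p + 1) * (real (Suc k) * c (Suc k) s)"
    by (rule DERIV_unique)
  then have "real (Suc k) * (s * (real (Suc (Suc k)) * c (Suc (Suc k)) s))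
      = real (Suc k) * (s * C (Suc k) s + C k s - (real (Suc k) + p + 1) * c (Suc k) s)"
    by (simp add: algebra_simps)
  then have "s * (real (Suc (Suc k)) * c (Suc (Suc k)) s)
      = s * C (Suc k) s + C k s - (real (Suc k) + p + 1) * c (Suc k) s"
    unfolding mult_cancel_left by simp
  then show ?case
    by (simp only: C_def nat.case)
qed

text \<open>The quotient rule brings in order \<open>p + 2\<close>, which the three-term recurrence
  at \<open>s / 4\<close> expresses through orders \<open>p\<close> and
  \<open>p + 1\<close>.\<close>

lemma bessel_D_riccati:
  assumes "p > -1" "s > 0" "bessel_F p (s / 4) \<noteq> 0"
    and d: "(bessel_D p has_real_derivative d) (at s)"
  shows "s * d = s * (bessel_D p s)\<^sup>2 - (p + 1) * bessel_D p s + 1 / 4"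
proof -
  define A B C where "A = bessel_F p (s / 4)" and "B = bessel_F (p + 1) (s / 4)"
    and "C = bessel_F (p + 2) (s / 4)"
  have A: "A \<noteq> 0"
    using assms by (simp add: A_def)
  have dF: "((\<lambda>s. bessel_F \<nu> (s / 4)) has_real_derivative - bessel_F (\<nu> + 1) (s / 4) * (1 / 4)) (at s)"
    if "\<nu> > -1" for \<nu>
    using DERIV_chain2[OF bessel_F_deriv[OF that] DERIV_cdivide[OF DERIV_ident]] .
  have "((\<lambda>s. bessel_F (p + 1) (s / 4) / (4 * bessel_F p (s / 4))) has_real_derivative
      (- C * (1 / 4) * (4 * A) - B * (4 * (- B * (1 / 4)))) / (4 * A * (4 * A))) (at s)"
    using DERIV_divide[OF dF[of "p + 1"] DERIV_cmult[OF dF[of p], of 4]] assms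
    by (simp add: A_def B_def C_def add_ac)
  then have "(bessel_D p has_real_derivative
      (- C * (1 / 4) * (4 * A) - B * (4 * (- B * (1 / 4)))) / (4 * A * (4 * A))) (at s)"
    by (rule has_field_derivative_transform_within_open[of _ _ _ "{0<..}"])
      (use assms in \<open>auto simp: bessel_D_eq\<close>)
  from DERIV_unique[OF d this]
  have "d = (- C * (1 / 4) * (4 * A) - B * (4 * (- B * (1 / 4)))) / (4 * A * (4 * A))" .
  also have "\<dots> = (B\<^sup>2 - A * C) / (16 * A\<^sup>2)"
    by (simp add: power2_eq_square mult_ac)
  finally have d_eq: "d = (B\<^sup>2 - A * C) / (16 * A\<^sup>2)" .
  have "s * C = 4 * ((p + 1) * B - A)"
    using bessel_F_recurrence[OF assms(1), of "s / 4"] by (simp add: A_def B_def C_def)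
  moreover have "s * (B\<^sup>2 - A * C) = s * B\<^sup>2 - A * (s * C)"
    by (simp add: algebra_simps)
  ultimately have "s * (B\<^sup>2 - A * C) = s * B\<^sup>2 - A * (4 * ((p + 1) * B - A))"
    by simp
  then have "s * d = (s * B\<^sup>2 - A * (4 * ((p + 1) * B - A))) / (16 * A\<^sup>2)"
    unfolding d_eq by simp
  also have "\<dots> = s * (B / (4 * A))\<^sup>2 - (p + 1) * (B / (4 * A)) + 1 / 4"
    using A by (simp add: field_simps power2_eq_square)
  finally show ?thesis
    using assms by (simp add: bessel_D_eq A_def B_def)
qed

section \<open>Sums over the zeros and their recurrence\<close>

theorem mainTheorem3:
  fixes p \<zeta> :: real and n :: nat and \<beta> :: "nat \<Rightarrow> real"
  assumes "n \<ge> 1"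
    and "(p > -1 \<and> \<zeta> = (bessel_zero (p + 1) n)\<^sup>2) \<or> (p > 0 \<and> \<zeta> = (bessel_zero (p - 1) n)\<^sup>2)"
    and "\<And>k. \<beta> k = (deriv ^^ k) (bessel_D p) \<zeta> / fact k"
  shows "(\<forall>r\<ge>1. (\<lambda>m. 1 / ((bessel_zero p (Suc m))\<^sup>2 - \<zeta>) ^ r) sums \<beta> (r - 1))
    \<and> (p > -1 \<and> \<zeta> = (bessel_zero (p + 1) n)\<^sup>2 \<longrightarrow> \<beta> 0 = 0)
    \<and> (p > 0 \<and> \<zeta> = (bessel_zero (p - 1) n)\<^sup>2 \<longrightarrow> \<beta> 0 = p / \<zeta>)
    \<and> \<zeta> * \<beta> 1 - \<zeta> * (\<beta> 0)\<^sup>2 + (p + 1) * \<beta> 0 - 1 / 4 = 0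
    \<and> (\<forall>k\<ge>1. \<beta> (k + 1) = 1 / (\<zeta> * (real k + 1)) *
          (\<zeta> * (\<Sum>j=0..k. \<beta> j * \<beta> (k - j)) + (\<Sum>j=0..k - 1. \<beta> j * \<beta> (k - 1 - j))
            - (real k + p + 1) * \<beta> k))"
proof -
  have p: "p > -1"
    using assms(2) by auto
  obtain i where n: "n = Suc i"
    using assms(1) by (cases n) auto
  have zero: "(bessel_zero \<nu> n)\<^sup>2 > 0" "bessel_F \<nu> ((bessel_zero \<nu> n)\<^sup>2 / 4) = 0" if "\<nu> > -1" for \<nu>
    using bessel_zero_squares(1)[OF that, of i] bessel_zero_squares(3)[OF that, of "(bessel_zero \<nu> n)\<^sup>2"]
    by (auto simp: n)
  have upper: "\<zeta> > 0 \<and> bessel_F (p + 1) (\<zeta> / 4) = 0" if "\<zeta> = (bessel_zero (p + 1) n)\<^sup>2"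
    using zero[of "p + 1"] p that by auto
  have lower: "\<zeta> > 0 \<and> bessel_F (p - 1) (\<zeta> / 4) = 0" if "p > 0" "\<zeta> = (bessel_zero (p - 1) n)\<^sup>2"
    using zero[of "p - 1"] that by auto
  have \<zeta>: "\<zeta> > 0"
    using assms(2) upper lower by blast
  \<comment> \<open>In either case \<zeta> comes from a zero of an order adjacent to
    \<open>p\<close>, and consecutive orders have no common zero.\<close>
  have F: "bessel_F p (\<zeta> / 4) \<noteq> 0"
    using assms(2)
  proof
    assume "p > -1 \<and> \<zeta> = (bessel_zero (p + 1) n)\<^sup>2"
    then show ?thesis
      using bessel_F_no_common_zero[of p "\<zeta> / 4"] upper by auto
  next
    assume "p > 0 \<and> \<zeta> = (bessel_zero (p - 1) n)\<^sup>2"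
    then show ?thesis
      using bessel_F_no_common_zero[of "p - 1" "\<zeta> / 4"] lower by auto
  qed
  define a where "a = (\<lambda>k. (bessel_zero p (Suc k))\<^sup>2)"
  have a: "summable (\<lambda>k. 1 / a k)" "a k > 0"
    "bessel_F p (s / 4) = 0 \<longleftrightarrow> s \<in> range a"
    "s \<notin> range a \<Longrightarrow> bessel_F (p + 1) (s / 4) / (4 * bessel_F p (s / 4)) = (\<Sum>k. 1 / (a k - s))"
    for k s
    unfolding a_def by (rule bessel_zero_squares[OF p]; simp)+
  have a\<zeta>: "a k \<noteq> \<zeta>" for k
    using F a(3)[of \<zeta>] by auto
  have sum: "summable (\<lambda>k. 1 / \<bar>a k - \<zeta>\<bar>)"
    using inverse_shift_summable[of a \<zeta>, OF a(1,2)] a\<zeta> by auto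
  have ev: "\<forall>\<^sub>F s in nhds \<zeta>. s \<notin> range a \<longrightarrow> bessel_D p s = (\<Sum>k. 1 / (a k - s))"
    using eventually_nhds_in_open[of "{0<..}" \<zeta>] \<zeta>
    by (auto elim!: eventually_mono simp: bessel_D_eq[OF p] a(4))
  obtain U where U: "open U" "\<zeta> \<in> U"
    "\<And>r s. s \<in> U \<Longrightarrow> (\<lambda>k. 1 / (a k - s) ^ Suc r) sums ((deriv ^^ r) (bessel_D p) s / fact r)"
    "\<And>r s. s \<in> U \<Longrightarrow> ((\<lambda>s. (deriv ^^ r) (bessel_D p) s / fact r) has_real_derivative
       real (Suc r) * ((deriv ^^ Suc r) (bessel_D p) s / fact (Suc r))) (at s)"
    by (rule partial_fractions_higher_deriv[OF a\<zeta> sum ev]) (rule that; assumption)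
  define c where "c = (\<lambda>k s. (deriv ^^ k) (bessel_D p) s / fact k)"
  have c: "\<beta> k = c k \<zeta>" for k
    by (simp add: assms(3) c_def)
  \<comment> \<open>Inside \<open>U\<close> the Riccati equation is available only for positive
    \<open>s\<close> off the zeros of the denominator, and these conditions are open.\<close>
  define V where "V = U \<inter> {0<..} \<inter> {s. bessel_F p (s / 4) \<noteq> 0}"
  have "isCont (\<lambda>s. bessel_F p (s / 4)) s" for s
    by (rule DERIV_isCont[OF DERIV_chain2[OF bessel_F_deriv[OF p] DERIV_cdivide[OF DERIV_ident]]])
  then have "continuous_on UNIV (\<lambda>s. bessel_F p (s / 4))"
    by (simp add: continuous_at_imp_continuous_on)
  then have V: "open V" "\<zeta> \<in> V"
    using U(1,2) \<zeta> F by (auto simp: V_def intro!: open_Int open_Collect_neq continuous_on_const)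
  have riccati: "s * c 1 s = s * (c 0 s)\<^sup>2 - (p + 1) * c 0 s + 1 / 4" if "s \<in> V" for s
    using bessel_D_riccati[OF p, of s "c 1 s"] U(4)[of s 0] that
    by (auto simp: V_def c_def)
  have rec: "\<zeta> * (real (Suc k) * \<beta> (Suc k))
      = \<zeta> * (\<Sum>j=0..k. \<beta> j * \<beta> (k - j))
        + (case k of 0 \<Rightarrow> 1 / 4 | Suc i \<Rightarrow> \<Sum>j=0..i. \<beta> j * \<beta> (i - j))
        - (real k + p + 1) * \<beta> k" for k
    unfolding c
    by (rule riccati_taylor_recurrence[OF V(1) _ riccati V(2)])
      (use U(4) in \<open>auto simp: V_def c_def\<close>)
  have \<beta>0: "\<beta> 0 = bessel_F (p + 1) (\<zeta> / 4) / (4 * bessel_F p (\<zeta> / 4))"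
    using bessel_D_eq[OF p \<zeta>] by (simp add: assms(3))
  show ?thesis
  proof (intro conjI allI impI)
    fix r :: nat assume "r \<ge> 1"
    then show "(\<lambda>m. 1 / ((bessel_zero p (Suc m))\<^sup>2 - \<zeta>) ^ r) sums \<beta> (r - 1)"
      using U(3)[OF U(2), of "r - 1"] by (simp add: a_def assms(3))
  next
    assume "p > -1 \<and> \<zeta> = (bessel_zero (p + 1) n)\<^sup>2"
    then show "\<beta> 0 = 0"
      using upper \<beta>0 by simp
  next
    assume "p > 0 \<and> \<zeta> = (bessel_zero (p - 1) n)\<^sup>2"
    \<comment> \<open>The recurrence for order \<open>p - 1\<close> loses its left side at \<zeta>
      and so fixes the quotient of the orders \<open>p + 1\<close> and \<open>p\<close>.\<close>
    then have "p * bessel_F p (\<zeta> / 4) = \<zeta> / 4 * bessel_F (p + 1) (\<zeta> / 4)"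
      using lower bessel_F_recurrence[of "p - 1" "\<zeta> / 4"] by (auto simp: add_ac)
    then show "\<beta> 0 = p / \<zeta>"
      unfolding \<beta>0 using F \<zeta> by (simp add: field_simps)
  next
    show "\<zeta> * \<beta> 1 - \<zeta> * (\<beta> 0)\<^sup>2 + (p + 1) * \<beta> 0 - 1 / 4 = 0"
      unfolding c riccati[OF V(2)] by simp
  next
    fix k :: nat assume "k \<ge> 1"
    then obtain i where "k = Suc i"
      by (cases k) auto
    define X :: real where "X = \<zeta> * (\<Sum>j=0..k. \<beta> j * \<beta> (k - j))
      + (\<Sum>j=0..k - 1. \<beta> j * \<beta> (k - 1 - j)) - (real k + p + 1) * \<beta> k"
    have "\<zeta> * (real (Suc k) * \<beta> (Suc k)) = X"
      using rec[of k] unfolding X_def \<open>k = Suc i\<close> nat.case diff_Suc_1 .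
    moreover have "real k + 1 \<noteq> 0"
      by linarith
    ultimately have "\<beta> (k + 1) = 1 / (\<zeta> * (real k + 1)) * X"
      using \<zeta> by (auto simp: add.commute)
    then show "\<beta> (k + 1) = 1 / (\<zeta> * (real k + 1)) *
          (\<zeta> * (\<Sum>j=0..k. \<beta> j * \<beta> (k - j)) + (\<Sum>j=0..k - 1. \<beta> j * \<beta> (k - 1 - j))
            - (real k + p + 1) * \<beta> k)"
      unfolding X_def .
  qed
qed

end
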